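(* Let $B$ be a noise Boolean algebra under an essentially separable probability $\mathbb P$, with stable $\sigma$-field $\sigma_{\mathrm{stb}}$. Then $\sigma_{\mathrm{stb}}\in\mathrm{Cl}(B)$.
   Context: For a probability $\mathbb P$, $\hat{\mathbb P}$ is the lattice of all $\mathbb P$-complete sub-$\sigma$-fields (those containing all $\mathbb P$-null events), with meet $\wedge=$ intersection and join $x\vee y=\sigma(x\cup y)$; $0_{\mathbb P}=\mathbb P^{-1}(\{0,1\})$ is the trivial $\sigma$-field and $1_{\mathbb P}$ the domain of $\mathbb P$. $\mathbb P$ is essentially separable if the (complex) space $L^2(\mathbb P)$ is separable. An independent complement of $x\in\hat{\mathbb P}$ is a $y\in\hat{\mathbb P}$ independent of $x$ with $x\vee y=1_{\mathbb P}$. A noise Boolean algebra under $\mathbb P$ is a distributive sublattice $B$ of $\hat{\mathbb P}$ containing $0_{\mathbb P}$ and $1_{\mathbb P}$ such that every $x\in B$ has an independent complement in $B$; this complement is then unique within $B$ and denoted $x'$. $\mathrm{Cl}(B)$, the sequential monotone closure of $B$, is the smallest subset of $\hat{\mathbb P}$ containing $B$ and closed under joins of nondecreasing sequences and meets of nonincreasing sequences; equivalently (a known fact) $\mathrm{Cl}(B)=\{\liminf_{n\to\infty}x_n:(x_n)\text{ a sequence in }B\}$, where $\liminf_n x_n=\bigvee_n\bigwedge_{m\ge n}x_m$. The first chaos of $B$ is $H^{(1)}=\{f\in L^2(\mathbb P):f=\mathbb P[f\mid x]+\mathbb P[f\mid x']\text{ for all }x\in B\}$ ($\mathbb P[\cdot\mid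 x]$ being conditional expectation), and the stable $\sigma$-field is $\sigma_{\mathrm{stb}}=\sigma(H^{(1)})\vee0_{\mathbb P}$. *)

theory Defs
  imports "HOL-Probability.Probability"
begin

text \<open>
  Sub-sigma-fields of a probability \<open>M\<close> are represented as sets of events, ordered by inclusion;
  the meet is the intersection. The probability \<open>M\<close> itself is not required to be complete: null
  events are elements of \<open>sets M\<close>.
\<close>

definition complete_subfields :: "'a measure \<Rightarrow> 'a set set set" where
  "complete_subfields M =
     {x. sigma_algebra (space M) x \<and> x \<subseteq> sets M \<and> null_sets M \<subseteq> x}"

definition sjoin :: "'a measure \<Rightarrow> 'a set set \<Rightarrow> 'a set set \<Rightarrow> 'a set set" where
  "sjoin M x y = sigma_sets (space M) (x \<union> y)"

definition trivial_field :: "'a measure \<Rightarrow> 'a set set" where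
  "trivial_field M = {A \<in> sets M. measure M A \<in> {0, 1}}"

definition indep_complement :: "'a measure \<Rightarrow> 'a set set \<Rightarrow> 'a set set \<Rightarrow> bool" where
  "indep_complement M x y \<longleftrightarrow>
     y \<in> complete_subfields M \<and> prob_space.indep_set M x y \<and> sjoin M x y = sets M"

definition noise_Boolean_algebra :: "'a measure \<Rightarrow> 'a set set set \<Rightarrow> bool" where
  "noise_Boolean_algebra M B \<longleftrightarrow>
     B \<subseteq> complete_subfields M \<and>
     trivial_field M \<in> B \<and> sets M \<in> B \<and>
     (\<forall>x\<in>B. \<forall>y\<in>B. x \<inter> y \<in> B \<and> sjoin M x y \<in> B) \<and>
     (\<forall>x\<in>B. \<forall>y\<in>B. \<forall>z\<in>B. x \<inter> sjoin M y z = sjoin M (x \<inter> y) (x \<inter> z)) \<and>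
     (\<forall>x\<in>B. \<exists>y\<in>B. indep_complement M x y)"

definition compl_in :: "'a measure \<Rightarrow> 'a set set set \<Rightarrow> 'a set set \<Rightarrow> 'a set set" where
  "compl_in M B x = (THE y. y \<in> B \<and> indep_complement M x y)"

lemma noise_Boolean_algebraD:
  assumes "noise_Boolean_algebra M B"
  shows "B \<subseteq> complete_subfields M"
    and "x \<in> B \<Longrightarrow> y \<in> B \<Longrightarrow> x \<inter> y \<in> B"
    and "x \<in> B \<Longrightarrow> y \<in> B \<Longrightarrow> z \<in> B \<Longrightarrow> x \<inter> sjoin M y z = sjoin M (x \<inter> y) (x \<inter> z)"
    and "x \<in> B \<Longrightarrow> \<exists>y\<in>B. indep_complement M x y"
  using assms by (simp_all add: noise_Boolean_algebra_def)

lemma trivial_field_subset: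
  assumes "prob_space M" "x \<in> complete_subfields M"
  shows "trivial_field M \<subseteq> x"
proof
  interpret prob_space M by fact
  interpret x: sigma_algebra "space M" x
    using assms(2) by (simp add: complete_subfields_def)
  fix A assume "A \<in> trivial_field M"
  then have A: "A \<in> events" "prob A = 0 \<or> prob A = 1"
    by (auto simp: trivial_field_def)
  have null: "N \<in> x" if "N \<in> events" "prob N = 0" for N
    using that assms(2) by (auto simp: complete_subfields_def null_sets_def emeasure_eq_measure)
  show "A \<in> x"
  proof (cases "prob A = 0")
    case True
    then show ?thesis using null A by blast
  next
    case False
    then have "space M - A \<in> x" using A by (intro null) (auto simp: prob_compl)
    then have "space M - (space M - A) \<in> x" by (rule x.compl_sets)
    then show ?thesis using sets.sets_into_space[OF A(1)] by (simp add: double_diff)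
  qed
qed

lemma indep_complement_le:
  assumes M: "prob_space M" and B: "noise_Boolean_algebra M B"
    and "x \<in> B" "y \<in> B" "z \<in> B" "indep_complement M x y" "indep_complement M x z"
  shows "y \<subseteq> z"
proof -
  interpret prob_space M by fact
  have cs: "y \<in> complete_subfields M" "y \<inter> z \<in> complete_subfields M"
    using noise_Boolean_algebraD[OF B] assms(4,5) by (metis subsetD)+
  interpret yz: sigma_algebra "space M" "y \<inter> z"
    using cs(2) by (simp add: complete_subfields_def)
  have "y \<subseteq> sets M" using cs by (auto simp: complete_subfields_def)
  moreover have "prob A = 0 \<or> prob A = 1" if "A \<in> y" "A \<in> x" for A
  proof -
    have "prob (A \<inter> A) = prob A * prob A"
      using assms(6) that by (intro indep_setD[of x y]) (auto simp: indep_complement_def)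
    then show ?thesis by simp
  qed
  ultimately have triv: "y \<inter> x \<subseteq> trivial_field M"
    by (auto simp: trivial_field_def)
  have "y = y \<inter> sjoin M x z"
    using \<open>y \<subseteq> sets M\<close> assms(7) by (auto simp: indep_complement_def)
  also have "\<dots> = sjoin M (y \<inter> x) (y \<inter> z)"
    using noise_Boolean_algebraD(3)[OF B assms(4,3,5)] .
  also have "\<dots> \<subseteq> y \<inter> z"
    unfolding sjoin_def using triv trivial_field_subset[OF M cs(2)]
    by (intro yz.sigma_sets_subset Un_least order_refl) (rule order_trans)
  finally show ?thesis by simp
qed

lemma compl_in_unique:
  assumes "prob_space M" "noise_Boolean_algebra M B" "x \<in> B"
  shows "\<exists>!y. y \<in> B \<and> indep_complement M x y"
proof -
  obtain y where y: "y \<in> B" "indep_complement M x y"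
    using noise_Boolean_algebraD(4)[OF assms(2,3)] by (elim bexE)
  show ?thesis
  proof (rule ex1I)
    fix z assume "z \<in> B \<and> indep_complement M x z"
    then show "z = y"
      using y indep_complement_le[OF assms] by (intro antisym) simp_all
  qed (simp add: y)
qed

text \<open>
  The closure stays inside \<open>complete_subfields M\<close> whenever \<open>B\<close> does, since
  \<open>complete_subfields M\<close> is itself closed under both operations.
\<close>

inductive_set seq_monotone_closure :: "'a measure \<Rightarrow> 'a set set set \<Rightarrow> 'a set set set"
  for M :: "'a measure" and B :: "'a set set set" where
  base: "x \<in> B \<Longrightarrow> x \<in> seq_monotone_closure M B"
| join: "(\<And>n::nat. X n \<in> seq_monotone_closure M B) \<Longrightarrow> incseq X \<Longrightarrow>
    sigma_sets (space M) (\<Union>n. X n) \<in> seq_monotone_closure M B"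
| meet: "(\<And>n::nat. X n \<in> seq_monotone_closure M B) \<Longrightarrow> decseq X \<Longrightarrow>
    (\<Inter>n. X n) \<in> seq_monotone_closure M B"

text \<open>
  Elements of the complex \<open>L\<^sup>2\<close> space are represented by functions rather than by classes modulo
  almost sure equality; identities between them are therefore stated almost everywhere.
\<close>

definition L2_fun :: "'a measure \<Rightarrow> ('a \<Rightarrow> complex) set" where
  "L2_fun M = {f \<in> borel_measurable M. integrable M (\<lambda>w. (cmod (f w))\<^sup>2)}"

definition L2_dist :: "'a measure \<Rightarrow> ('a \<Rightarrow> complex) \<Rightarrow> ('a \<Rightarrow> complex) \<Rightarrow> real" where
  "L2_dist M f g = sqrt (\<integral>w. (cmod (f w - g w))\<^sup>2 \<partial>M)"

definition essentially_separable :: "'a measure \<Rightarrow> bool" where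
  "essentially_separable M \<longleftrightarrow>
     (\<exists>D. countable D \<and> D \<subseteq> L2_fun M \<and> (\<forall>f\<in>L2_fun M. \<forall>e>0. \<exists>g\<in>D. L2_dist M f g < e))"

definition complex_cond_exp :: "'a measure \<Rightarrow> 'a set set \<Rightarrow> ('a \<Rightarrow> complex) \<Rightarrow> 'a \<Rightarrow> complex" where
  "complex_cond_exp M x f =
     (\<lambda>w. Complex (real_cond_exp M (sigma (space M) x) (\<lambda>w. Re (f w)) w)
                  (real_cond_exp M (sigma (space M) x) (\<lambda>w. Im (f w)) w))"

definition first_chaos :: "'a measure \<Rightarrow> 'a set set set \<Rightarrow> ('a \<Rightarrow> complex) set" where
  "first_chaos M B =
     {f \<in> L2_fun M. \<forall>x\<in>B. AE w in M.
        f w = complex_cond_exp M x f w + complex_cond_exp M (compl_in M B x) f w}"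

definition stable_field :: "'a measure \<Rightarrow> 'a set set set \<Rightarrow> 'a set set" where
  "stable_field M B =
     sjoin M
       (sigma_sets (space M) {f -` A \<inter> space M | f A. f \<in> first_chaos M B \<and> A \<in> sets borel})
       (trivial_field M)"

end

theory Submission
  imports Defs
begin

text \<open>
  Write \<open>P x\<close> for the conditional expectation on \<open>x\<close>, acting on real square integrable functions,
  and \<open>N c = 1 - P c\<close>. For \<open>x\<close> and \<open>y\<close> in \<open>B\<close> these projections satisfy \<open>P x P y = P (x \<inter> y)\<close>,
  so they commute and have a joint spectral picture: a function is spread over subsets \<open>s\<close> of an
  imaginary space whose clopen sets are the elements of \<open>B\<close>, and \<open>P x\<close> keeps the part with
  \<open>s\<close> inside \<open>x\<close>. The first chaos is the part carried by one-point sets, and the functions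
  measurable for the stable field are those carried by finite sets.

  The elements \<open>x m\<close> of \<open>B\<close> whose lower limit is the stable field come from random thinning.
  Take a fine finite partition in \<open>B\<close> and delete each cell with a small probability \<open>q\<close>. A function
  in the first chaos loses on average at most the fraction \<open>q\<close> of its squared norm. A function
  carried by infinite sets loses almost everything: once \<open>s\<close> meets \<open>n\<close> cells, it survives with
  probability at most \<open>(1 - q) ^ n\<close>. Averaging over the deletions produces one \<open>x\<close> that does both
  for finitely many functions at once (\<open>thinning_exists\<close>). The average is kept as a recursion along
  the list of cells, so that no random variables are introduced.

  By separability, countably many functions suffice on either side. Let the allowed losses be
  summable in \<open>m\<close>. Then every function of the first chaos is measurable for the lower limit
  (\<open>meet_approx\<close>). Conversely, if an event belongs to all \<open>x m\<close> from some index on, its indicator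
  minus the projection to the stable field is fixed by these \<open>P (x m)\<close>, which tend to zero on it;
  hence the event is stable.

  What carries the argument is that a function whose conditional expectation on the stable field
  vanishes has no part on finite sets (\<open>finite_level_vanish\<close>). No spectral theorem is used: that
  \<open>s\<close> meets fewer than \<open>n\<close> cells is expressed by the vanishing of every product
  \<open>N c\<^sub>1 \<dots> N c\<^sub>n\<close> whose \<open>c\<close>'s have pairwise disjoint complements. If \<open>n + 1\<close> factors always kill \<open>v\<close>,
  then a product \<open>g\<close> of \<open>n\<close> of them applied to \<open>v\<close> has exactly one point in each of \<open>n\<close> cells, and
  its partial integrals over all cells but one lie in the first chaos (\<open>slice_H1\<close>). So inside \<open>g\<close>
  one cell after the other can be replaced by its stable part (\<open>slice_all\<close>), and \<open>g\<close> vanishes.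
  A minimization using the completeness of the space (\<open>L2_complete\<close>, \<open>Z_small\<close>) turns this into the
  quantitative form that the thinning needs.
\<close>

section \<open>Square integrable functions and projections\<close>

definition fdiff :: "('a \<Rightarrow> real) \<Rightarrow> ('a \<Rightarrow> real) \<Rightarrow> 'a \<Rightarrow> real" (infixl "\<ominus>" 65) where
  "u \<ominus> v = (\<lambda>w. u w - v w)"

definition cop :: "(('a \<Rightarrow> real) \<Rightarrow> 'a \<Rightarrow> real) \<Rightarrow> ('a \<Rightarrow> real) \<Rightarrow> 'a \<Rightarrow> real" where
  "cop T u = u \<ominus> T u"

context prob_space
begin

text \<open>
  Functions are not identified modulo null sets; equality in the Hilbert space is the relation
  \<open>\<doteq>\<close>, and linearity and congruence of operators hold only up to it.
\<close>
definition L2 :: "('a \<Rightarrow> real) set" where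
  "L2 = {u \<in> borel_measurable M. integrable M (\<lambda>w. (u w)\<^sup>2)}"

definition ip :: "('a \<Rightarrow> real) \<Rightarrow> ('a \<Rightarrow> real) \<Rightarrow> real" where
  "ip u v = (\<integral>w. u w * v w \<partial>M)"

definition nsq :: "('a \<Rightarrow> real) \<Rightarrow> real" where
  "nsq u = ip u u"

definition aeq :: "('a \<Rightarrow> real) \<Rightarrow> ('a \<Rightarrow> real) \<Rightarrow> bool" (infix "\<doteq>" 50) where
  "u \<doteq> v \<longleftrightarrow> (AE w in M. u w = v w)"

lemma L2_I: "u \<in> borel_measurable M \<Longrightarrow> integrable M (\<lambda>w. (u w)\<^sup>2) \<Longrightarrow> u \<in> L2"
  unfolding L2_def by blast

lemma L2_meas: "u \<in> L2 \<Longrightarrow> u \<in> borel_measurable M"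
  unfolding L2_def by blast

lemma L2_sq: "u \<in> L2 \<Longrightarrow> integrable M (\<lambda>w. (u w)\<^sup>2)"
  unfolding L2_def by blast

lemma integrable_ip:
  assumes "u \<in> L2" "v \<in> L2"
  shows "integrable M (\<lambda>w. u w * v w)"
proof (rule Bochner_Integration.integrable_bound)
  show "integrable M (\<lambda>w. (u w)\<^sup>2 + (v w)\<^sup>2)"
    using assms by (intro Bochner_Integration.integrable_add L2_sq)
  show "(\<lambda>w. u w * v w) \<in> borel_measurable M"
    using assms by (intro borel_measurable_times L2_meas)
  have "\<bar>a * b\<bar> \<le> a\<^sup>2 + b\<^sup>2" for a b :: real
    using sum_squares_bound[of "\<bar>a\<bar>" "\<bar>b\<bar>"] mult_nonneg_nonneg[of "\<bar>a\<bar>" "\<bar>b\<bar>"]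
    unfolding abs_mult power2_abs by linarith
  then show "AE w in M. norm (u w * v w) \<le> norm ((u w)\<^sup>2 + (v w)\<^sup>2)"
    by (auto intro!: AE_I2)
qed

lemma L2_const: "(\<lambda>w. c) \<in> L2"
  by (intro L2_I borel_measurable_const integrable_const)

lemma L2_integrable: assumes "u \<in> L2" shows "integrable M u"
proof -
  have "integrable M (\<lambda>w. u w * 1)" using assms L2_const by (rule integrable_ip)
  then show ?thesis by simp
qed

lemma L2_add: assumes "u \<in> L2" "v \<in> L2" shows "(\<lambda>w. u w + v w) \<in> L2"
proof (rule L2_I)
  note 1 = assms[THEN L2_sq]
  have "integrable M (\<lambda>w. (u w)\<^sup>2 + (v w)\<^sup>2 + 2 * (u w * v w))"
    by (intro Bochner_Integration.integrable_add integrable_mult_right 1 integrable_ip assms)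
  then show "integrable M (\<lambda>w. (u w + v w)\<^sup>2)"
    by (simp only: power2_sum mult.assoc)
  show "(\<lambda>w. u w + v w) \<in> borel_measurable M"
    using assms by (intro borel_measurable_add L2_meas)
qed

lemma L2_cmult: assumes "u \<in> L2" shows "(\<lambda>w. c * u w) \<in> L2"
proof (rule L2_I)
  show "integrable M (\<lambda>w. (c * u w)\<^sup>2)"
    unfolding power_mult_distrib by (intro integrable_mult_right L2_sq assms)
  show "(\<lambda>w. c * u w) \<in> borel_measurable M"
    using assms by (intro borel_measurable_times borel_measurable_const L2_meas)
qed

lemma L2_fdiff: "u \<in> L2 \<Longrightarrow> v \<in> L2 \<Longrightarrow> u \<ominus> v \<in> L2"
  using L2_add[OF _ L2_cmult, of u v "-1"] by (simp add: fdiff_def)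

lemma L2_bound:
  assumes "u \<in> L2" "v \<in> borel_measurable M" "AE w in M. \<bar>v w\<bar> \<le> \<bar>u w\<bar>"
  shows "v \<in> L2"
proof (intro L2_I assms(2))
  show "integrable M (\<lambda>w. (v w)\<^sup>2)"
  proof (rule Bochner_Integration.integrable_bound)
    show "integrable M (\<lambda>w. (u w)\<^sup>2)" by (intro L2_sq assms)
    show "(\<lambda>w. (v w)\<^sup>2) \<in> borel_measurable M" by (intro borel_measurable_power assms)
    show "AE w in M. norm ((v w)\<^sup>2) \<le> norm ((u w)\<^sup>2)"
      using assms(3) by eventually_elim (simp add: abs_le_square_iff)
  qed
qed

lemma L2_indicator_mult:
  assumes "u \<in> L2" "A \<in> sets M"
  shows "(\<lambda>w. u w * indicator A w) \<in> L2"
proof (rule L2_bound[OF assms(1)])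
  show "(\<lambda>w. u w * indicator A w) \<in> borel_measurable M"
    using assms by (intro borel_measurable_times L2_meas borel_measurable_indicator)
qed (auto simp: indicator_def)

lemma L2_indicator: "A \<in> sets M \<Longrightarrow> (indicator A :: 'a \<Rightarrow> real) \<in> L2"
  using L2_indicator_mult[OF L2_const[of 1]] by simp

lemma aeq_refl[simp, intro]: "u \<doteq> u"
  by (simp add: aeq_def)

lemma aeq_sym: "u \<doteq> v \<Longrightarrow> v \<doteq> u"
  by (simp add: aeq_def eq_commute)

lemma aeq_trans[trans]: assumes "u \<doteq> v" "v \<doteq> t" shows "u \<doteq> t"
  using assms unfolding aeq_def by eventually_elim simp

lemma fdiff_cong: assumes "u \<doteq> u'" "v \<doteq> v'" shows "u \<ominus> v \<doteq> u' \<ominus> v'"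
  using assms unfolding aeq_def fdiff_def by eventually_elim simp

lemma ip_commute: "ip u v = ip v u"
  by (simp add: ip_def mult.commute)

lemma ip_cong:
  assumes "u \<doteq> u'" "v \<doteq> v'" "u \<in> L2" "u' \<in> L2" "v \<in> L2" "v' \<in> L2"
  shows "ip u v = ip u' v'"
  unfolding ip_def
proof (rule integral_cong_AE)
  show "AE w in M. u w * v w = u' w * v' w"
    using assms(1,2) unfolding aeq_def by eventually_elim simp
qed (use assms in \<open>auto intro: L2_meas borel_measurable_times\<close>)

lemma nsq_cong: "u \<doteq> u' \<Longrightarrow> u \<in> L2 \<Longrightarrow> u' \<in> L2 \<Longrightarrow> nsq u = nsq u'"
  unfolding nsq_def by (rule ip_cong)

lemma ip_diff_left: "u \<in> L2 \<Longrightarrow> v \<in> L2 \<Longrightarrow> t \<in> L2 \<Longrightarrow> ip (u \<ominus> v) t = ip u t - ip v t"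
  by (simp add: ip_def fdiff_def left_diff_distrib integrable_ip)

lemma ip_diff_right: "u \<in> L2 \<Longrightarrow> v \<in> L2 \<Longrightarrow> t \<in> L2 \<Longrightarrow> ip t (u \<ominus> v) = ip t u - ip t v"
  using ip_diff_left ip_commute by metis

lemma ip_add_left:
  "u \<in> L2 \<Longrightarrow> v \<in> L2 \<Longrightarrow> t \<in> L2 \<Longrightarrow> ip (\<lambda>w. u w + v w) t = ip u t + ip v t"
  by (simp add: ip_def distrib_right integrable_ip)

lemma ip_0: "ip (\<lambda>w. 0) u = 0" "ip u (\<lambda>w. 0) = 0"
  by (simp_all add: ip_def)

lemma nsq_nonneg: "0 \<le> nsq u"
  by (simp add: nsq_def ip_def)

lemma nsq_diff: "u \<in> L2 \<Longrightarrow> v \<in> L2 \<Longrightarrow> nsq (u \<ominus> v) = nsq u - 2 * ip u v + nsq v"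
  using ip_commute[of u v] by (simp add: nsq_def ip_diff_left ip_diff_right L2_fdiff)

lemma nsq_eq_0: assumes "u \<in> L2" shows "nsq u = 0 \<longleftrightarrow> u \<doteq> (\<lambda>w. 0)"
proof -
  have "integrable M (\<lambda>w. (u w)\<^sup>2)" using assms by (rule L2_sq)
  from integral_nonneg_eq_0_iff_AE[OF this] show ?thesis
    by (simp add: nsq_def ip_def aeq_def power2_eq_square)
qed

lemma aeq_diff: "u \<doteq> v \<longleftrightarrow> u \<ominus> v \<doteq> (\<lambda>w. 0)"
  by (simp add: aeq_def fdiff_def)

lemma aeqI_ip:
  assumes "u \<in> L2" "v \<in> L2" "\<And>t. t \<in> L2 \<Longrightarrow> ip u t = ip v t"
  shows "u \<doteq> v"
proof -
  have "nsq (u \<ominus> v) = 0"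
    using assms by (simp add: nsq_def ip_diff_left L2_fdiff)
  then show ?thesis using nsq_eq_0[OF L2_fdiff[OF assms(1,2)]] aeq_diff by simp
qed

lemma nsq_triangle2:
  assumes "u \<in> L2" "v \<in> L2" "t \<in> L2"
  shows "nsq (u \<ominus> t) \<le> 2 * nsq (u \<ominus> v) + 2 * nsq (v \<ominus> t)"
proof -
  have L: "u \<ominus> v \<in> L2" "v \<ominus> t \<in> L2" using assms by (auto intro: L2_fdiff)
  have "0 \<le> nsq ((u \<ominus> v) \<ominus> (v \<ominus> t))" by (rule nsq_nonneg)
  also have "\<dots> = 2 * nsq (u \<ominus> v) + 2 * nsq (v \<ominus> t) - nsq (u \<ominus> t)"
    using assms L ip_commute[of v u] ip_commute[of t u] ip_commute[of t v]
    by (simp add: nsq_diff ip_diff_left ip_diff_right nsq_def[symmetric])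
  finally show ?thesis by simp
qed

lemma ip_le_sqrt: assumes "u \<in> L2" "v \<in> L2" shows "ip u v \<le> sqrt (nsq u) * sqrt (nsq v)"
proof -
  have "(ip u v)\<^sup>2 \<le> nsq u * nsq v"
  proof (cases "nsq v = 0")
    case True
    then have "ip u v = ip u (\<lambda>w. 0)"
      using nsq_eq_0[OF assms(2)] assms L2_const by (intro ip_cong) auto
    then show ?thesis using True by (simp add: ip_def)
  next
    case False
    then have pos: "nsq v > 0" using nsq_nonneg[of v] by simp
    define c where "c = ip u v / nsq v"
    have "0 \<le> nsq (u \<ominus> (\<lambda>w. c * v w))" by (rule nsq_nonneg)
    also have "\<dots> = nsq u - 2 * (c * ip u v) + c * c * nsq v"
      using assms nsq_diff[OF assms(1) L2_cmult[OF assms(2), of c]]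
      by (simp add: nsq_def ip_def algebra_simps)
    also have "\<dots> = nsq u - (ip u v)\<^sup>2 / nsq v"
      using pos by (simp add: c_def field_simps power2_eq_square)
    finally show ?thesis using pos by (simp add: field_simps)
  qed
  then have "sqrt ((ip u v)\<^sup>2) \<le> sqrt (nsq u * nsq v)" by (rule real_sqrt_le_mono)
  then show ?thesis by (simp add: real_sqrt_mult)
qed

lemma sqrt_nsq_triangle:
  assumes "u \<in> L2" "v \<in> L2" "t \<in> L2"
  shows "sqrt (nsq (u \<ominus> t)) \<le> sqrt (nsq (u \<ominus> v)) + sqrt (nsq (v \<ominus> t))"
proof -
  let ?a = "u \<ominus> v" and ?b = "v \<ominus> t"
  have L: "?a \<in> L2" "?b \<in> L2" using assms by (auto intro: L2_fdiff)
  have "nsq (u \<ominus> t) = nsq ?a + 2 * ip ?a ?b + nsq ?b"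
    using assms L ip_commute[of v u] ip_commute[of t u] ip_commute[of t v]
    by (simp add: nsq_diff ip_diff_left ip_diff_right nsq_def[symmetric])
  also have "\<dots> \<le> (sqrt (nsq ?a) + sqrt (nsq ?b))\<^sup>2"
    using ip_le_sqrt[OF L] nsq_nonneg by (simp add: power2_sum)
  finally show ?thesis
    by (rule real_le_lsqrt[rotated]) (simp add: nsq_nonneg)
qed

text \<open>
  Self-adjointness already forces linearity and compatibility with \<open>\<doteq>\<close>
  (\<open>proj_fdiff\<close>, \<open>proj_cong\<close>), since two functions with the same inner products agree
  almost everywhere.
\<close>
definition proj :: "(('a \<Rightarrow> real) \<Rightarrow> 'a \<Rightarrow> real) \<Rightarrow> bool" where
  "proj T \<longleftrightarrow> (\<forall>u\<in>L2. T u \<in> L2 \<and> T (T u) \<doteq> T u \<and> (\<forall>v\<in>L2. ip (T u) v = ip u (T v)))"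

definition commute :: "(('a \<Rightarrow> real) \<Rightarrow> 'a \<Rightarrow> real) \<Rightarrow> (('a \<Rightarrow> real) \<Rightarrow> 'a \<Rightarrow> real) \<Rightarrow> bool" where
  "commute S T \<longleftrightarrow> (\<forall>u\<in>L2. S (T u) \<doteq> T (S u))"

lemma proj_L2: "proj T \<Longrightarrow> u \<in> L2 \<Longrightarrow> T u \<in> L2"
  by (simp add: proj_def)
lemma proj_idem: "proj T \<Longrightarrow> u \<in> L2 \<Longrightarrow> T (T u) \<doteq> T u"
  by (simp add: proj_def)
lemma proj_ip: "proj T \<Longrightarrow> u \<in> L2 \<Longrightarrow> v \<in> L2 \<Longrightarrow> ip (T u) v = ip u (T v)"
  by (simp add: proj_def)

lemma proj_cong:
  assumes "proj T" "u \<doteq> v" "u \<in> L2" "v \<in> L2" shows "T u \<doteq> T v"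
  by (rule aeqI_ip)
     (use assms proj_L2[OF assms(1)] in \<open>auto simp: proj_ip[OF assms(1)] intro!: ip_cong\<close>)

lemma proj_fdiff:
  assumes "proj T" "u \<in> L2" "v \<in> L2" shows "T (u \<ominus> v) \<doteq> T u \<ominus> T v"
  by (rule aeqI_ip)
     (use assms proj_L2[OF assms(1)] L2_fdiff in \<open>auto simp: proj_ip[OF assms(1)] ip_diff_left\<close>)

lemma proj_add:
  assumes "proj T" "u \<in> L2" "v \<in> L2" shows "T (\<lambda>w. u w + v w) \<doteq> (\<lambda>w. T u w + T v w)"
  by (rule aeqI_ip)
     (use assms proj_L2[OF assms(1)] L2_add in \<open>auto simp: proj_ip[OF assms(1)] ip_add_left\<close>)

lemma proj_0: assumes "proj T" shows "T (\<lambda>w. 0) \<doteq> (\<lambda>w. 0)"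
  by (rule aeqI_ip)
     (use assms proj_L2[OF assms(1)] L2_const in \<open>auto simp: proj_ip[OF assms(1)] ip_0\<close>)

lemma proj_ip_self: assumes "proj T" "u \<in> L2" shows "ip u (T u) = nsq (T u)"
proof -
  have "nsq (T u) = ip u (T (T u))" using assms proj_L2[OF assms(1)] by (simp add: nsq_def proj_ip[OF assms(1)])
  also have "\<dots> = ip u (T u)" using assms proj_L2[OF assms(1)] proj_idem[OF assms(1)] by (intro ip_cong) auto
  finally show ?thesis by simp
qed

lemma cop_L2: "proj T \<Longrightarrow> u \<in> L2 \<Longrightarrow> cop T u \<in> L2"
  using proj_L2[of T u] by (simp add: cop_def L2_fdiff)

lemma nsq_proj_cop: assumes "proj T" "u \<in> L2" shows "nsq u = nsq (T u) + nsq (cop T u)"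
  using assms proj_L2[OF assms(1)] by (simp add: cop_def nsq_diff proj_ip_self[OF assms(1)])

lemma nsq_proj_le: assumes "proj T" "u \<in> L2" shows "nsq (T u) \<le> nsq u"
  using nsq_proj_cop[OF assms] nsq_nonneg[of "cop T u"] by simp

lemma proj_cop: assumes "proj T" shows "proj (cop T)"
  unfolding proj_def
proof (intro ballI conjI)
  fix u assume u: "u \<in> L2"
  show "cop T u \<in> L2" using cop_L2[OF assms u] .
  have "T (cop T u) \<doteq> T u \<ominus> T (T u)"
    unfolding cop_def using assms u proj_L2[OF assms(1)] by (intro proj_fdiff[OF assms(1)]) auto
  also have "\<dots> \<doteq> T u \<ominus> T u" using proj_idem[OF assms u] by (intro fdiff_cong) auto
  finally show "cop T (cop T u) \<doteq> cop T u"
    by (auto simp: cop_def aeq_def fdiff_def)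
  fix v assume v: "v \<in> L2"
  show "ip (cop T u) v = ip u (cop T v)"
    using assms u v proj_L2[OF assms(1)] by (simp add: cop_def ip_diff_left ip_diff_right proj_ip[OF assms(1)])
qed

lemma proj_proj_cop: assumes "proj T" "u \<in> L2" shows "T (cop T u) \<doteq> (\<lambda>w. 0)"
proof -
  have "T (cop T u) \<doteq> T u \<ominus> T (T u)"
    unfolding cop_def using assms proj_L2[OF assms(1)] by (intro proj_fdiff[OF assms(1)]) auto
  also have "\<dots> \<doteq> T u \<ominus> T u" using proj_idem[OF assms] by (intro fdiff_cong) auto
  finally show ?thesis by (simp add: fdiff_def)
qed

lemma cop_eq_0: "cop T u \<doteq> (\<lambda>w. 0) \<longleftrightarrow> T u \<doteq> u"
proof -
  have "u w - T u w = 0 \<longleftrightarrow> T u w = u w" for w by auto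
  then show ?thesis by (simp only: cop_def aeq_def fdiff_def)
qed

lemma commute_sym: "commute S T \<Longrightarrow> commute T S"
  by (auto simp: commute_def intro: aeq_sym)

lemma commuteD: "commute S T \<Longrightarrow> u \<in> L2 \<Longrightarrow> S (T u) \<doteq> T (S u)"
  by (simp add: commute_def)

lemma commute_cop: assumes "proj S" "proj T" "commute S T" shows "commute S (cop T)"
  unfolding commute_def
proof
  fix u assume u: "u \<in> L2"
  have "S (cop T u) \<doteq> S u \<ominus> S (T u)"
    unfolding cop_def using assms u proj_L2[OF assms(1)] proj_L2[OF assms(2)] by (intro proj_fdiff[OF assms(1)]) auto
  also have "\<dots> \<doteq> S u \<ominus> T (S u)" using commuteD[OF assms(3) u] by (intro fdiff_cong) auto
  finally show "S (cop T u) \<doteq> cop T (S u)" by (simp add: cop_def)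
qed

lemma commute_comp:
  assumes "proj R" "proj S" "proj T" "commute R S" "commute R T"
  shows "commute R (S \<circ> T)"
  unfolding commute_def
proof
  fix u assume u: "u \<in> L2"
  have "R (S (T u)) \<doteq> S (R (T u))" using commuteD[OF assms(4) proj_L2[OF assms(3) u]] .
  also have "\<dots> \<doteq> S (T (R u))" using commuteD[OF assms(5) u] u proj_L2[OF assms(1)] proj_L2[OF assms(3)] assms(2)
    by (intro proj_cong[OF assms(2)]) auto
  finally show "R ((S \<circ> T) u) \<doteq> (S \<circ> T) (R u)" by simp
qed

lemma proj_comp:
  assumes "proj S" "proj T" "commute S T" shows "proj (S \<circ> T)"
  unfolding proj_def
proof (intro ballI conjI)
  fix u assume u: "u \<in> L2"
  show "(S \<circ> T) u \<in> L2" using u assms proj_L2[OF assms(1)] proj_L2[OF assms(2)] by simp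
  have "S (T (S (T u))) \<doteq> S (S (T (T u)))"
    using assms u proj_L2[OF assms(1)] proj_L2[OF assms(2)] commute_sym[OF assms(3)] by (intro proj_cong[OF assms(1)]) (auto simp: commute_def)
  also have "\<dots> \<doteq> S (T (T u))" using assms u proj_L2[OF assms(1)] proj_L2[OF assms(2)] by (intro proj_idem[OF assms(1)]) auto
  also have "\<dots> \<doteq> S (T u)" using assms u proj_L2[OF assms(1)] proj_L2[OF assms(2)] proj_idem[OF assms(2)] by (intro proj_cong[OF assms(1)]) auto
  finally show "(S \<circ> T) ((S \<circ> T) u) \<doteq> (S \<circ> T) u" by simp
  fix v assume v: "v \<in> L2"
  have "ip (S (T u)) v = ip u (T (S v))" using assms u v proj_L2[OF assms(1)] proj_L2[OF assms(2)] by (simp add: proj_ip[OF assms(1)] proj_ip[OF assms(2)])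
  also have "\<dots> = ip u (S (T v))" using assms u v proj_L2[OF assms(1)] proj_L2[OF assms(2)] commuteD[OF assms(3) v]
    by (intro ip_cong) (auto intro: aeq_sym)
  finally show "ip ((S \<circ> T) u) v = ip u ((S \<circ> T) v)" by simp
qed

text \<open>
  Pythagoras for \<open>S u\<close>, with the two parts moved past \<open>S\<close> by commutation.
\<close>
lemma nsq_commute_split:
  assumes "proj S" "proj T" "commute S T" "u \<in> L2"
  shows "nsq (S u) = nsq (S (T u)) + nsq (S (cop T u))"
proof -
  have "nsq (S u) = nsq (T (S u)) + nsq (cop T (S u))"
    using assms proj_L2[OF assms(1)] proj_L2[OF assms(2)] by (intro nsq_proj_cop[OF assms(2)]) auto
  also have "nsq (T (S u)) = nsq (S (T u))"
    using assms proj_L2[OF assms(1)] proj_L2[OF assms(2)] commuteD[OF assms(3,4)] by (intro nsq_cong) (auto intro: aeq_sym)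
  also have "nsq (cop T (S u)) = nsq (S (cop T u))"
    using assms proj_L2[OF assms(1)] proj_L2[OF assms(2)] commuteD[OF commute_cop[OF assms(1-3)] assms(4)] cop_L2[OF assms(2)]
    by (intro nsq_cong) (auto intro: aeq_sym)
  finally show ?thesis .
qed

end

section \<open>Conditional expectations on complete subfields\<close>

lemma csubD:
  assumes "x \<in> complete_subfields M"
  shows "sigma_algebra (space M) x" "x \<subseteq> sets M" "null_sets M \<subseteq> x"
  using assms by (auto simp: complete_subfields_def)

lemma csub_Int: "x \<in> complete_subfields M \<Longrightarrow> y \<in> complete_subfields M \<Longrightarrow> x \<inter> y \<in> complete_subfields M"
  by (auto simp: complete_subfields_def sigma_algebra_iff2 image_subset_iff)

lemma csub_sigma_sets:
  assumes "S \<subseteq> sets M" "null_sets M \<subseteq> S"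
  shows "sigma_sets (space M) S \<in> complete_subfields M"
  unfolding complete_subfields_def
proof (intro CollectI conjI)
  show "sigma_algebra (space M) (sigma_sets (space M) S)"
    using assms(1) sets.space_closed[of M] by (intro sigma_algebra_sigma_sets) auto
  show "sigma_sets (space M) S \<subseteq> sets M" using assms(1) by (rule sets.sigma_sets_subset)
  show "null_sets M \<subseteq> sigma_sets (space M) S" using assms(2) by (auto intro: sigma_sets.Basic)
qed

lemma sjoin_csub:
  assumes "x \<in> complete_subfields M" "y \<in> complete_subfields M"
  shows "sjoin M x y \<in> complete_subfields M"
  unfolding sjoin_def using csubD[OF assms(1)] csubD[OF assms(2)] by (intro csub_sigma_sets) auto

lemma sjoin_upper: "x \<subseteq> sjoin M x y" "y \<subseteq> sjoin M x y"
  by (auto simp: sjoin_def)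

lemma sjoin_least:
  assumes "z \<in> complete_subfields M" "x \<subseteq> z" "y \<subseteq> z" shows "sjoin M x y \<subseteq> z"
  unfolding sjoin_def
  using assms sigma_algebra.sigma_sets_subset[OF csubD(1)[OF assms(1)], of "x \<union> y"] by simp

lemma sjoin_commute: "sjoin M x y = sjoin M y x"
  by (simp add: sjoin_def Un_commute)

lemma sjoin_mono: "x \<subseteq> x' \<Longrightarrow> y \<subseteq> y' \<Longrightarrow> sjoin M x y \<subseteq> sjoin M x' y'"
  unfolding sjoin_def by (intro sigma_sets_mono') auto

lemma top_csub: "sets M \<in> complete_subfields M"
  by (auto simp: complete_subfields_def sets.sigma_algebra_axioms)

context prob_space
begin

definition F :: "'a set set \<Rightarrow> 'a measure" where
  "F x = sigma (space M) x"

definition P :: "'a set set \<Rightarrow> ('a \<Rightarrow> real) \<Rightarrow> 'a \<Rightarrow> real" where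
  "P x u = real_cond_exp M (F x) u"

lemma sets_F: "x \<in> complete_subfields M \<Longrightarrow> sets (F x) = x"
  using csubD[of x M] by (simp add: F_def sigma_algebra.sets_measure_of_eq)

lemma space_F: "x \<in> complete_subfields M \<Longrightarrow> space (F x) = space M"
  unfolding F_def by (simp add: space_measure_of_conv)

lemma subalgebra_F: "x \<in> complete_subfields M \<Longrightarrow> subalgebra M (F x)"
  using csubD(2)[of x M] by (simp add: subalgebra_def sets_F space_F)

lemma subalgebra_F_mono:
  "x \<in> complete_subfields M \<Longrightarrow> y \<in> complete_subfields M \<Longrightarrow> x \<subseteq> y \<Longrightarrow> subalgebra (F y) (F x)"
  by (simp add: subalgebra_def sets_F space_F)

lemma sigma_finite_F: "x \<in> complete_subfields M \<Longrightarrow> sigma_finite_subalgebra M (F x)"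
  using finite_measure_axioms
  by (intro finite_measure_subalgebra_is_sigma_finite)
     (simp add: finite_measure_subalgebra_def finite_measure_subalgebra_axioms_def subalgebra_F)

lemma measF_M: "x \<in> complete_subfields M \<Longrightarrow> u \<in> borel_measurable (F x) \<Longrightarrow> u \<in> borel_measurable M"
  using measurable_from_subalg[OF subalgebra_F] by blast

lemma measF_mono:
  "x \<in> complete_subfields M \<Longrightarrow> y \<in> complete_subfields M \<Longrightarrow> x \<subseteq> y \<Longrightarrow>
    u \<in> borel_measurable (F x) \<Longrightarrow> u \<in> borel_measurable (F y)"
  using measurable_from_subalg[OF subalgebra_F_mono] by blast

lemma measF_indicator:
  "x \<in> complete_subfields M \<Longrightarrow> A \<in> x \<Longrightarrow> (indicator A :: 'a \<Rightarrow> real) \<in> borel_measurable (F x)"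
  by (intro borel_measurable_indicator) (simp add: sets_F)

text \<open>
  This is where completeness of the subfields enters: changing a function on a null set does not
  affect measurability, so being measurable for \<open>x\<close> can be tested by \<open>P x u \<doteq> u\<close>.
\<close>
lemma measF_aeq:
  assumes x: "x \<in> complete_subfields M" and u: "u \<in> borel_measurable (F x)"
    and v: "v \<in> borel_measurable M" and eq: "u \<doteq> v"
  shows "v \<in> borel_measurable (F x)"
proof (rule measurableI)
  interpret x: sigma_algebra "space M" x by (rule csubD(1)[OF x])
  fix A :: "real set" assume A: "A \<in> sets borel"
  have U: "u -` A \<inter> space M \<in> x" using measurable_sets[OF u A] x by (simp add: sets_F space_F)
  have uM: "u \<in> borel_measurable M" using measF_M[OF x u] .
  define N where "N = {w \<in> space M. u w \<noteq> v w}"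
  have "{w \<in> space M. \<not> (u w = v w)} \<in> sets M" using uM v by measurable
  then have N: "N \<in> null_sets M"
    using eq unfolding aeq_def N_def by (simp add: AE_iff_null)
  have s: "v -` A \<inter> space M \<inter> N \<in> null_sets M"
    using N v A by (intro null_set_Int1 N) (auto intro: measurable_sets)
  have "v -` A \<inter> space M = ((u -` A \<inter> space M) - N) \<union> (v -` A \<inter> space M \<inter> N)"
    by (auto simp: N_def)
  also have "\<dots> \<in> x" using U N s csubD(3)[OF x] by (intro x.Un x.Diff) auto
  finally show "v -` A \<inter> space (F x) \<in> sets (F x)" using x by (simp add: sets_F space_F)
qed simp

lemma measF_Int:
  fixes u :: "'a \<Rightarrow> real"
  assumes x: "x \<in> complete_subfields M" and y: "y \<in> complete_subfields M"
    and u: "u \<in> borel_measurable (F x)" "u \<in> borel_measurable (F y)"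
  shows "u \<in> borel_measurable (F (x \<inter> y))"
proof (rule measurableI)
  fix A :: "real set" assume A: "A \<in> sets borel"
  show "u -` A \<inter> space (F (x \<inter> y)) \<in> sets (F (x \<inter> y))"
    using measurable_sets[OF u(1) A] measurable_sets[OF u(2) A] csub_Int[OF x y] x y
    by (simp add: sets_F space_F)
qed simp

lemma P_meas: "P x u \<in> borel_measurable (F x)"
  by (simp add: P_def borel_measurable_cond_exp)

lemma P_meas_M: "P x u \<in> borel_measurable M"
  unfolding P_def by (rule borel_measurable_cond_exp2)

lemma P_L2: assumes x: "x \<in> complete_subfields M" and u: "u \<in> L2" shows "P x u \<in> L2"
proof (rule L2_I[OF P_meas_M])
  interpret sigma_finite_subalgebra M "F x" using sigma_finite_F[OF x] .
  have c: "convex_on UNIV (\<lambda>t::real. t\<^sup>2)"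
    using convex_power_even[of 2] by simp
  show "integrable M (\<lambda>w. (P x u w)\<^sup>2)"
    unfolding P_def
    by (rule integrable_convex_cond_exp[where q="\<lambda>t. t\<^sup>2" and I=UNIV])
       (use c L2_integrable[OF u] L2_sq[OF u] in auto)
qed

lemma P_ip:
  assumes x: "x \<in> complete_subfields M" and u: "u \<in> L2" and v: "v \<in> L2" "v \<in> borel_measurable (F x)"
  shows "ip (P x u) v = ip u v"
proof -
  interpret sigma_finite_subalgebra M "F x" using sigma_finite_F[OF x] .
  have "(\<integral>w. v w * P x u w \<partial>M) = (\<integral>w. v w * u w \<partial>M)"
    unfolding P_def using integrable_ip[OF v(1) u] v(2) L2_meas[OF u] by (rule real_cond_exp_intg(2))
  then show ?thesis by (simp add: ip_def mult.commute)
qed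

lemma P_fix:
  assumes x: "x \<in> complete_subfields M" and u: "u \<in> L2" "u \<in> borel_measurable (F x)"
  shows "P x u \<doteq> u"
proof -
  interpret sigma_finite_subalgebra M "F x" using sigma_finite_F[OF x] .
  show ?thesis unfolding P_def aeq_def by (rule real_cond_exp_F_meas[OF L2_integrable[OF u(1)] u(2)])
qed

lemma P_fixD:
  assumes x: "x \<in> complete_subfields M" and u: "u \<in> L2" "P x u \<doteq> u"
  shows "u \<in> borel_measurable (F x)"
  by (rule measF_aeq[OF x P_meas L2_meas[OF u(1)] u(2)])

lemma proj_P: assumes x: "x \<in> complete_subfields M" shows "proj (P x)"
  unfolding proj_def
proof (intro ballI conjI)
  fix u assume u: "u \<in> L2"
  note Pu = P_L2[OF x u]
  show "P x u \<in> L2" using Pu .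
  show "P x (P x u) \<doteq> P x u" by (rule P_fix[OF x Pu P_meas])
  fix v assume v: "v \<in> L2"
  note Pv = P_L2[OF x v]
  have "ip (P x u) v = ip v (P x u)" by (rule ip_commute)
  also have "\<dots> = ip (P x v) (P x u)" by (rule P_ip[OF x v Pu P_meas, symmetric])
  also have "\<dots> = ip (P x u) (P x v)" by (rule ip_commute)
  also have "\<dots> = ip u (P x v)" by (rule P_ip[OF x u Pv P_meas])
  finally show "ip (P x u) v = ip u (P x v)" .
qed

lemmas P_cong = proj_cong[OF proj_P]

lemma P_mult:
  assumes x: "x \<in> complete_subfields M" and "v \<in> borel_measurable (F x)" "u \<in> L2" "(\<lambda>w. v w * u w) \<in> L2"
  shows "P x (\<lambda>w. v w * u w) \<doteq> (\<lambda>w. v w * P x u w)"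
proof -
  interpret sigma_finite_subalgebra M "F x" using sigma_finite_F[OF x] .
  show ?thesis unfolding P_def aeq_def
    by (rule real_cond_exp_mult[OF assms(2) L2_meas[OF assms(3)] L2_integrable[OF assms(4)]])
qed

lemma P_mono1:
  assumes "x \<in> complete_subfields M" "y \<in> complete_subfields M" "x \<subseteq> y" "u \<in> L2"
  shows "P y (P x u) \<doteq> P x u"
  using assms by (intro P_fix P_L2 measF_mono[OF assms(1,2,3) P_meas])

lemma P_mono2:
  assumes "x \<in> complete_subfields M" "y \<in> complete_subfields M" "x \<subseteq> y" "u \<in> L2"
  shows "P x (P y u) \<doteq> P x u"
proof -
  interpret sigma_finite_subalgebra M "F x" using sigma_finite_F[OF assms(1)] .
  show ?thesis unfolding P_def aeq_def
    by (intro real_cond_exp_nested_subalg subalgebra_F subalgebra_F_mono L2_integrable assms)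
qed

lemma ip_indicator: "ip u (indicator A) = (\<integral>w\<in>A. u w \<partial>M)"
  by (simp add: ip_def set_lebesgue_integral_def mult.commute)

lemma P_eqI:
  assumes x: "x \<in> complete_subfields M" and "u \<in> L2" "v \<in> L2" "v \<in> borel_measurable (F x)"
    and "\<And>A. A \<in> x \<Longrightarrow> ip u (indicator A) = ip v (indicator A)"
  shows "P x u \<doteq> v"
proof -
  interpret sigma_finite_subalgebra M "F x" using sigma_finite_F[OF x] .
  show ?thesis unfolding P_def aeq_def
    using assms(5) sets_F[OF x]
    by (intro real_cond_exp_charact L2_integrable assms) (simp add: ip_indicator)
qed

lemma measF_0: "(\<lambda>w. 0) \<in> borel_measurable (F x)"
  by (rule borel_measurable_const)

text \<open>
  The sets orthogonal to \<open>u\<close> are closed under complements and disjoint countable unions, so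
  Dynkin's theorem applies.
\<close>
lemma sigma_sets_ip_0:
  assumes u: "u \<in> L2" and G: "Int_stable G" "G \<subseteq> sets M" "space M \<in> G"
    and 0: "\<And>A. A \<in> G \<Longrightarrow> ip u (indicator A) = 0"
    and A: "A \<in> sigma_sets (space M) G"
  shows "ip u (indicator A) = 0"
proof -
  have sub: "G \<subseteq> Pow (space M)" using G(2) sets.space_closed[of M] by blast
  have sM: "A \<in> sets M" if "A \<in> sigma_sets (space M) G" for A
    using that sets.sigma_sets_subset[OF G(2)] by auto
  have si: "set_integrable M A u" if "A \<in> sigma_sets (space M) G" for A
    using integrable_mult_indicator[OF sM[OF that] L2_integrable[OF u]]
    by (simp add: set_integrable_def)
  show ?thesis using G(1) sub A
  proof (induction rule: sigma_sets_induct_disjoint)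
    case (basic A) then show ?case using 0 by simp
  next
    case empty then show ?case by (simp add: ip_def)
  next
    case (compl A)
    have "(\<integral>w\<in>space M. u w \<partial>M) = (\<integral>w\<in>A \<union> (space M - A). u w \<partial>M)"
      using sets.sets_into_space[OF sM[OF compl(1)]] by (simp add: Un_absorb1)
    also have "\<dots> = (\<integral>w\<in>A. u w \<partial>M) + (\<integral>w\<in>space M - A. u w \<partial>M)"
      using compl(1) by (intro set_integral_Un si sigma_sets.Compl) auto
    finally show ?case using compl(2) 0[OF G(3)] by (simp add: ip_indicator)
  next
    case (union A)
    have U: "(\<Union>i. A i) \<in> sigma_sets (space M) G" using union(2) by (intro sigma_sets.Union) auto
    have "(\<integral>w\<in>(\<Union>i. A i). u w \<partial>M) = (\<Sum>i. (\<integral>w\<in>A i. u w \<partial>M))"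
    proof (rule lebesgue_integral_countable_add)
      show "A i \<in> events" for i using union(2) by (intro sM) auto
      show "A i \<inter> A j = {}" if "i \<noteq> j" for i j
        using union(1) that by (auto simp: disjoint_family_on_def)
    qed (rule si[OF U])
    then show ?case using union(3) by (simp add: ip_indicator)
  qed
qed

lemma sjoin_ip_0:
  assumes x: "x \<in> complete_subfields M" and y: "y \<in> complete_subfields M" and u: "u \<in> L2"
    and 0: "\<And>A C. A \<in> x \<Longrightarrow> C \<in> y \<Longrightarrow> ip u (indicator (A \<inter> C)) = 0"
    and A: "A \<in> sjoin M x y"
  shows "ip u (indicator A) = 0"
proof -
  interpret x: sigma_algebra "space M" x by (rule csubD(1)[OF x])
  interpret y: sigma_algebra "space M" y by (rule csubD(1)[OF y])
  define G where "G = {A \<inter> C | A C. A \<in> x \<and> C \<in> y}"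
  have "x \<union> y \<subseteq> G"
  proof
    fix A assume "A \<in> x \<union> y"
    then show "A \<in> G"
    proof
      assume "A \<in> x"
      then have "A = A \<inter> space M" using x.sets_into_space by blast
      then show ?thesis using \<open>A \<in> x\<close> y.top unfolding G_def by blast
    next
      assume "A \<in> y"
      then have "A = space M \<inter> A" using y.sets_into_space by blast
      then show ?thesis using \<open>A \<in> y\<close> x.top unfolding G_def by blast
    qed
  qed
  then have A': "A \<in> sigma_sets (space M) G"
    using A unfolding sjoin_def by (meson sigma_sets_mono' subsetD)
  show ?thesis
  proof (rule sigma_sets_ip_0[OF u _ _ _ _ A'])
    show "Int_stable G" unfolding Int_stable_def
    proof (intro ballI)
      fix a b assume "a \<in> G" "b \<in> G"
      then obtain A C A' C' where *: "a = A \<inter> C" "b = A' \<inter> C'" "A \<in> x" "A' \<in> x" "C \<in> y" "C' \<in> y"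
        unfolding G_def by blast
      have "a \<inter> b = (A \<inter> A') \<inter> (C \<inter> C')" using * by blast
      then show "a \<inter> b \<in> G" unfolding G_def using * x.Int y.Int by blast
    qed
    show "G \<subseteq> sets M" unfolding G_def using csubD(2)[OF x] csubD(2)[OF y] by blast
    show "space M \<in> G" using \<open>x \<union> y \<subseteq> G\<close> x.top by blast
    show "ip u (indicator A) = 0" if "A \<in> G" for A using that 0 unfolding G_def by blast
  qed
qed

lemma indep_ip:
  assumes x: "x \<in> complete_subfields M" and i: "indep_set x y" "C \<in> y"
    and u: "u \<in> L2" "u \<in> borel_measurable (F x)"
  shows "ip u (indicator C) = prob C * expectation u"
proof -
  have C: "C \<in> events" using i unfolding indep_set_def indep_sets_def by (auto split: bool.splits)
  have "P x (indicator C) \<doteq> (\<lambda>w. prob C)"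
  proof (rule P_eqI[OF x L2_indicator[OF C] L2_const borel_measurable_const])
    fix A assume A: "A \<in> x"
    then have AM: "A \<in> events" using csubD(2)[OF x] by blast
    have "ip (indicator C) (indicator A) = (\<integral>w. indicator (A \<inter> C) w \<partial>M)"
      by (simp add: ip_def indicator_inter_arith mult.commute)
    also have "\<dots> = prob (A \<inter> C)" using AM C by simp
    also have "\<dots> = prob A * prob C" using indep_setD[OF i(1) A i(2)] .
    also have "\<dots> = ip (\<lambda>w. prob C) (indicator A)" using AM by (simp add: ip_def)
    finally show "ip (indicator C) (indicator A) = ip (\<lambda>w. prob C) (indicator A)" .
  qed
  then have "ip (P x (indicator C)) u = ip (\<lambda>w. prob C) u"
    using P_L2[OF x L2_indicator[OF C]] L2_const u by (intro ip_cong) auto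
  moreover have "ip (P x (indicator C)) u = ip (indicator C) u"
    using P_ip[OF x L2_indicator[OF C] u] .
  ultimately show ?thesis by (simp add: ip_commute[of u]) (simp add: ip_def)
qed

text \<open>
  If \<open>y\<close> splits along an independent pair \<open>x\<close>, \<open>c\<close>, then \<open>P x\<close> and \<open>P y\<close> compose to the
  conditional expectation on the meet. It suffices to test against products of an event \<open>U\<close> in
  \<open>y \<inter> x\<close> and an event \<open>V\<close> in \<open>y \<inter> c\<close>; there \<open>V\<close> only contributes its probability, and \<open>U\<close>
  lies in both fields.
  Applied with \<open>y\<close> in \<open>B\<close> and with \<open>y\<close> the stable field, this makes all projections of the
  proof commute.
\<close>
lemma P_P_split:
  assumes x: "x \<in> complete_subfields M" and c: "c \<in> complete_subfields M" and i: "indep_set x c"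
    and y: "y \<in> complete_subfields M" and sub: "y \<subseteq> sjoin M (y \<inter> x) (y \<inter> c)" and u: "u \<in> L2"
  shows "P y (P x u) \<doteq> P (x \<inter> y) u"
proof -
  have xy: "x \<inter> y \<in> complete_subfields M" "y \<inter> x \<in> complete_subfields M" "y \<inter> c \<in> complete_subfields M"
    using x y c by (auto intro: csub_Int)
  let ?d = "P x u \<ominus> P (x \<inter> y) u"
  have L: "P x u \<in> L2" "P (x \<inter> y) u \<in> L2" using P_L2 x xy u by auto
  have d: "?d \<in> L2" "?d \<in> borel_measurable (F x)"
    using L P_meas measF_mono[OF xy(1) x _ P_meas[of "x \<inter> y"]]
    by (auto simp: fdiff_def intro!: L2_fdiff[unfolded fdiff_def])
  have 0: "ip ?d (indicator A) = 0" if A: "A \<in> sjoin M (y \<inter> x) (y \<inter> c)" for A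
  proof (rule sjoin_ip_0[OF xy(2,3) d(1) _ A])
    fix U V assume U: "U \<in> y \<inter> x" and V: "V \<in> y \<inter> c"
    have UM: "U \<in> events" using U csubD(2)[OF x] by blast
    let ?e = "\<lambda>w. ?d w * indicator U w"
    have e: "?e \<in> L2" "?e \<in> borel_measurable (F x)"
      using L2_indicator_mult[OF d(1) UM] measF_indicator[OF x, of U] U d(2) by auto
    have "ip ?d (indicator (U \<inter> V)) = ip ?e (indicator V)"
      by (simp add: ip_def indicator_inter_arith mult.assoc)
    also have "\<dots> = prob V * expectation ?e" using indep_ip[OF x i _ e] V by blast
    also have "expectation ?e = ip ?d (indicator U)" by (simp add: ip_def)
    also have "\<dots> = ip (P x u) (indicator U) - ip (P (x \<inter> y) u) (indicator U)"
      using L L2_indicator[OF UM] by (simp add: ip_diff_left)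
    also have "ip (P x u) (indicator U) = ip u (indicator U)"
      using U by (intro P_ip[OF x u] L2_indicator UM measF_indicator x) auto
    also have "ip (P (x \<inter> y) u) (indicator U) = ip u (indicator U)"
      using U by (intro P_ip[OF xy(1) u] L2_indicator UM measF_indicator xy) auto
    finally show "ip ?d (indicator (U \<inter> V)) = 0" by simp
  qed
  show ?thesis
  proof (rule P_eqI[OF y L])
    show "P (x \<inter> y) u \<in> borel_measurable (F y)" using measF_mono[OF xy(1) y _ P_meas] by auto
    fix A assume A: "A \<in> y"
    then have "A \<in> events" using csubD(2)[OF y] by blast
    then show "ip (P x u) (indicator A) = ip (P (x \<inter> y) u) (indicator A)"
      using 0[of A] A sub ip_diff_left[OF L L2_indicator] by auto
  qed
qed

text \<open>
  The composition in the other order, by taking adjoints.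
\<close>
lemma P_P_split':
  assumes x: "x \<in> complete_subfields M" and c: "c \<in> complete_subfields M" and i: "indep_set x c"
    and y: "y \<in> complete_subfields M" and sub: "y \<subseteq> sjoin M (y \<inter> x) (y \<inter> c)" and u: "u \<in> L2"
  shows "P x (P y u) \<doteq> P (x \<inter> y) u"
proof (rule aeqI_ip)
  have xy: "x \<inter> y \<in> complete_subfields M" using x y by (rule csub_Int)
  note pr = proj_P[OF x] proj_P[OF y] proj_P[OF xy]
  show "P x (P y u) \<in> L2" "P (x \<inter> y) u \<in> L2" by (intro P_L2 x y xy u)+
  fix t assume t: "t \<in> L2"
  have "ip (P x (P y u)) t = ip (P y u) (P x t)" by (rule proj_ip[OF pr(1) P_L2[OF y u] t])
  also have "\<dots> = ip u (P y (P x t))" by (rule proj_ip[OF pr(2) u P_L2[OF x t]])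
  also have "\<dots> = ip u (P (x \<inter> y) t)"
    using P_P_split[OF x c i y sub t] P_L2[OF y P_L2[OF x t]] P_L2[OF xy t] u by (intro ip_cong) auto
  also have "\<dots> = ip (P (x \<inter> y) u) t" by (rule proj_ip[OF pr(3) u t, symmetric])
  finally show "ip (P x (P y u)) t = ip (P (x \<inter> y) u) t" .
qed

end

section \<open>Noise Boolean algebras and the stable field\<close>

lemma (in prob_space) L2_fun_parts:
  assumes f: "f \<in> L2_fun M"
  shows "(\<lambda>w. Re (f w)) \<in> L2" "(\<lambda>w. Im (f w)) \<in> L2"
proof -
  have f': "f \<in> borel_measurable M" "integrable M (\<lambda>w. (cmod (f w))\<^sup>2)"
    using f unfolding L2_fun_def by blast+
  have m: "(\<lambda>w. Re (f w)) \<in> borel_measurable M" "(\<lambda>w. Im (f w)) \<in> borel_measurable M"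
    using f'(1) by measurable
  have "integrable M (\<lambda>w. (Re (f w))\<^sup>2)"
    using m(1) by (intro Bochner_Integration.integrable_bound[OF f'(2)]) (auto simp: cmod_power2)
  then show "(\<lambda>w. Re (f w)) \<in> L2" by (rule L2_I[OF m(1)])
  have "integrable M (\<lambda>w. (Im (f w))\<^sup>2)"
    using m(2) by (intro Bochner_Integration.integrable_bound[OF f'(2)]) (auto simp: cmod_power2)
  then show "(\<lambda>w. Im (f w)) \<in> L2" by (rule L2_I[OF m(2)])
qed

locale noise = prob_space +
  fixes B :: "'a set set set"
  assumes noise: "noise_Boolean_algebra M B"
begin

abbreviation triv :: "'a set set" where "triv \<equiv> trivial_field M"

abbreviation join :: "'a set set \<Rightarrow> 'a set set \<Rightarrow> 'a set set" (infixl "\<curlyvee>" 65) where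
  "x \<curlyvee> y \<equiv> sjoin M x y"

abbreviation cl :: "'a set set \<Rightarrow> 'a set set" where "cl x \<equiv> compl_in M B x"

abbreviation stb :: "'a set set" where "stb \<equiv> stable_field M B"

lemma B_csub: "x \<in> B \<Longrightarrow> x \<in> complete_subfields M"
  using noise_Boolean_algebraD(1)[OF noise] by blast

lemma triv_B: "triv \<in> B" and top_B: "sets M \<in> B"
  using noise by (auto simp: noise_Boolean_algebra_def)

lemma join_B: "x \<in> B \<Longrightarrow> y \<in> B \<Longrightarrow> x \<curlyvee> y \<in> B"
  using noise by (auto simp: noise_Boolean_algebra_def)

lemma Int_B: "x \<in> B \<Longrightarrow> y \<in> B \<Longrightarrow> x \<inter> y \<in> B"
  by (rule noise_Boolean_algebraD(2)[OF noise])

lemma distrib: "x \<in> B \<Longrightarrow> y \<in> B \<Longrightarrow> z \<in> B \<Longrightarrow> x \<inter> (y \<curlyvee> z) = (x \<inter> y) \<curlyvee> (x \<inter> z)"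
  by (rule noise_Boolean_algebraD(3)[OF noise])

lemma triv_least: "x \<in> complete_subfields M \<Longrightarrow> triv \<subseteq> x"
  by (rule trivial_field_subset[OF prob_space_axioms])

lemma cl_both: assumes "x \<in> B" shows "cl x \<in> B \<and> indep_complement M x (cl x)"
  unfolding compl_in_def by (rule theI'[OF compl_in_unique[OF prob_space_axioms noise assms]])

lemma cl_B: "x \<in> B \<Longrightarrow> cl x \<in> B"
  using cl_both by blast

lemma cl_indep: "x \<in> B \<Longrightarrow> indep_set x (cl x)"
  using cl_both unfolding indep_complement_def by blast

lemma cl_join: "x \<in> B \<Longrightarrow> x \<curlyvee> cl x = sets M"
  using cl_both unfolding indep_complement_def by blast

lemma cl_Int: assumes x: "x \<in> B" shows "x \<inter> cl x = triv"
proof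
  show "triv \<subseteq> x \<inter> cl x" using triv_least B_csub cl_B x by blast
  show "x \<inter> cl x \<subseteq> triv"
  proof
    fix A assume A: "A \<in> x \<inter> cl x"
    then have "prob (A \<inter> A) = prob A * prob A"
      using cl_indep[OF x] by (intro indep_setD) auto
    then have "prob A = 0 \<or> prob A = 1" by simp
    then show "A \<in> triv" using A csubD(2)[OF B_csub[OF x]] by (auto simp: trivial_field_def)
  qed
qed

lemma join_least: "z \<in> complete_subfields M \<Longrightarrow> x \<subseteq> z \<Longrightarrow> y \<subseteq> z \<Longrightarrow> x \<curlyvee> y \<subseteq> z"
  by (rule sjoin_least)

lemma distrib2:
  assumes x: "x \<in> B" and y: "y \<in> B" and z: "z \<in> B"
  shows "(x \<curlyvee> y) \<inter> (x \<curlyvee> z) = x \<curlyvee> (y \<inter> z)"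
proof
  have c: "x \<curlyvee> (y \<inter> z) \<in> complete_subfields M" using assms by (intro B_csub join_B Int_B)
  show "x \<curlyvee> (y \<inter> z) \<subseteq> (x \<curlyvee> y) \<inter> (x \<curlyvee> z)"
    by (intro Int_greatest sjoin_mono) auto
  have "(x \<curlyvee> y) \<inter> (x \<curlyvee> z) = ((x \<curlyvee> y) \<inter> x) \<curlyvee> ((x \<curlyvee> y) \<inter> z)"
    using assms by (intro distrib join_B)
  also have "(x \<curlyvee> y) \<inter> z = (z \<inter> x) \<curlyvee> (z \<inter> y)"
    using distrib[OF z x y] by (simp add: Int_commute)
  also have "((x \<curlyvee> y) \<inter> x) \<curlyvee> \<dots> \<subseteq> x \<curlyvee> (y \<inter> z)"
    using sjoin_upper[of x M "y \<inter> z"] sjoin_upper[of "y \<inter> z" M x]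
    by (intro join_least c) auto
  finally show "(x \<curlyvee> y) \<inter> (x \<curlyvee> z) \<subseteq> x \<curlyvee> (y \<inter> z)" .
qed

lemma join_triv: "x \<in> complete_subfields M \<Longrightarrow> x \<curlyvee> triv = x"
  using triv_least[of x] sjoin_upper[of x M triv] by (intro antisym join_least) auto

lemma le_top: "x \<in> complete_subfields M \<Longrightarrow> x \<subseteq> sets M"
  by (rule csubD(2))

lemma join_top_mono:
  assumes "x \<curlyvee> y = sets M" "x \<subseteq> x'" "y \<subseteq> y'" "x' \<in> complete_subfields M" "y' \<in> complete_subfields M"
  shows "x' \<curlyvee> y' = sets M"
  using sjoin_mono[OF assms(2,3), of M] assms(1) le_top[OF sjoin_csub[OF assms(4,5)]] by auto

lemma cl_le:
  assumes c: "c \<in> B" and d: "d \<in> B" and "c \<curlyvee> d = sets M" shows "cl d \<subseteq> c"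
proof -
  have "cl d = cl d \<inter> (c \<curlyvee> d)" using le_top[OF B_csub[OF cl_B[OF d]]] assms(3) by blast
  also have "\<dots> = (cl d \<inter> c) \<curlyvee> (cl d \<inter> d)" using c d by (intro distrib cl_B)
  also have "\<dots> \<subseteq> c" using cl_Int[OF d] triv_least[OF B_csub[OF c]] c
    by (intro join_least B_csub) (auto simp: Int_commute)
  finally show ?thesis .
qed

text \<open>
  In terms of complements: the cell \<open>cl y\<close> is cut into its parts inside \<open>cl x\<close> and inside \<open>x\<close>.
\<close>
lemma split_cl:
  assumes y: "y \<in> B" and x: "x \<in> B" shows "(y \<curlyvee> x) \<inter> (y \<curlyvee> cl x) = y"
  using distrib2[OF y x cl_B[OF x]] cl_Int[OF x] join_triv[OF B_csub[OF y]] by simp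

lemma P_P:
  assumes x: "x \<in> B" and y: "y \<in> B" and u: "u \<in> L2"
  shows "P y (P x u) \<doteq> P (x \<inter> y) u"
proof (rule P_P_split[OF _ _ cl_indep _ _ u])
  show "y \<subseteq> y \<inter> x \<curlyvee> y \<inter> cl x"
    using distrib[OF y x cl_B[OF x]] cl_join[OF x] le_top[OF B_csub[OF y]] by auto
qed (use x y B_csub cl_B in auto)

lemma commute_P: "x \<in> B \<Longrightarrow> y \<in> B \<Longrightarrow> commute (P x) (P y)"
  unfolding commute_def using P_P[of x y] P_P[of y x] by (metis Int_commute aeq_sym aeq_trans)

lemma proj_PB: "x \<in> B \<Longrightarrow> proj (P x)"
  by (rule proj_P[OF B_csub])

text \<open>
  The real functions of the first chaos. Conditional expectations act separately on real and
  imaginary parts, so they generate the same field as the complex ones.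
\<close>
definition H1 :: "('a \<Rightarrow> real) set" where
  "H1 = {f \<in> L2. \<forall>x\<in>B. f \<doteq> (\<lambda>w. P x f w + P (cl x) f w)}"

lemma H1_L2: "f \<in> H1 \<Longrightarrow> f \<in> L2" by (simp add: H1_def)

lemma H1_P: assumes f: "f \<in> H1" and x: "x \<in> B" shows "P x f \<in> H1"
  unfolding H1_def
proof (intro CollectI conjI ballI)
  have fL: "f \<in> L2" using H1_L2[OF f] .
  show L: "P x f \<in> L2" by (rule P_L2[OF B_csub[OF x] fL])
  fix z assume z: "z \<in> B"
  note c = B_csub[OF x] B_csub[OF z] B_csub[OF cl_B[OF z]]
  have zL: "P z f \<in> L2" "P (cl z) f \<in> L2" using P_L2 c fL by auto
  have "P x f \<doteq> P x (\<lambda>w. P z f w + P (cl z) f w)"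
    using f z fL by (intro P_cong[OF c(1)] L2_add zL) (auto simp: H1_def)
  also have "\<dots> \<doteq> (\<lambda>w. P x (P z f) w + P x (P (cl z) f) w)"
    by (rule proj_add[OF proj_P[OF c(1)] zL])
  also have "\<dots> \<doteq> (\<lambda>w. P z (P x f) w + P (cl z) (P x f) w)"
    using commuteD[OF commute_P[OF x z] fL] commuteD[OF commute_P[OF x cl_B[OF z]] fL]
    unfolding aeq_def by eventually_elim simp
  finally show "P x f \<doteq> (\<lambda>w. P z (P x f) w + P (cl z) (P x f) w)" .
qed

lemma H1_first_chaos: assumes f: "f \<in> H1" shows "(\<lambda>w. complex_of_real (f w)) \<in> first_chaos M B"
  unfolding first_chaos_def L2_fun_def
proof (intro CollectI conjI ballI)
  have fL: "f \<in> L2" using H1_L2[OF f] .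
  show "(\<lambda>w. complex_of_real (f w)) \<in> borel_measurable M" using L2_meas[OF fL] by measurable
  show "integrable M (\<lambda>w. (cmod (complex_of_real (f w)))\<^sup>2)" using L2_sq[OF fL] by simp
  fix x assume x: "x \<in> B"
  have 0: "P y (\<lambda>w. 0) \<doteq> (\<lambda>w. 0)" if "y \<in> B" for y by (rule proj_0[OF proj_PB[OF that]])
  have "f \<doteq> (\<lambda>w. P x f w + P (cl x) f w)" using f x by (simp add: H1_def)
  with 0[OF x] 0[OF cl_B[OF x]]
  show "AE w in M. complex_of_real (f w) = complex_cond_exp M x (\<lambda>w. complex_of_real (f w)) w +
    complex_cond_exp M (cl x) (\<lambda>w. complex_of_real (f w)) w"
    unfolding aeq_def complex_cond_exp_def P_def F_def
    by eventually_elim (simp add: complex_eq_iff)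
qed

lemma first_chaos_H1:
  assumes f: "f \<in> first_chaos M B"
  shows "(\<lambda>w. Re (f w)) \<in> H1" "(\<lambda>w. Im (f w)) \<in> H1"
proof -
  have L: "(\<lambda>w. Re (f w)) \<in> L2" "(\<lambda>w. Im (f w)) \<in> L2"
    using f by (auto simp: first_chaos_def intro: L2_fun_parts)
  have eq: "AE w in M. f w = complex_cond_exp M x f w + complex_cond_exp M (cl x) f w" if "x \<in> B" for x
    using f that unfolding first_chaos_def by blast
  have "(\<lambda>w. Re (f w)) \<doteq> (\<lambda>w. P x (\<lambda>w. Re (f w)) w + P (cl x) (\<lambda>w. Re (f w)) w)"
       "(\<lambda>w. Im (f w)) \<doteq> (\<lambda>w. P x (\<lambda>w. Im (f w)) w + P (cl x) (\<lambda>w. Im (f w)) w)" if "x \<in> B" for x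
    using eq[OF that] unfolding aeq_def complex_cond_exp_def P_def F_def
    by (eventually_elim, simp add: complex_eq_iff)+
  then show "(\<lambda>w. Re (f w)) \<in> H1" "(\<lambda>w. Im (f w)) \<in> H1"
    using L unfolding H1_def by blast+
qed

lemma stb_csub: "stb \<in> complete_subfields M"
proof -
  let ?G = "{f -` A \<inter> space M | f A. f \<in> first_chaos M B \<and> A \<in> sets borel}"
  have "?G \<subseteq> sets M"
    by (auto simp: first_chaos_def L2_fun_def intro: measurable_sets)
  then have "sigma_sets (space M) ?G \<subseteq> sets M" by (rule sets.sigma_sets_subset)
  then show ?thesis unfolding stable_field_def sjoin_def
    using csubD[OF B_csub[OF triv_B]] by (intro csub_sigma_sets) auto
qed

lemma H1_stb: assumes f: "f \<in> H1" shows "f \<in> borel_measurable (F stb)"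
proof (rule measurableI)
  fix A :: "real set" assume A: "A \<in> sets borel"
  have "Re -` A \<in> sets borel" using measurable_sets[OF borel_measurable_Re A] by simp
  then have "(\<lambda>w. complex_of_real (f w)) -` (Re -` A) \<inter> space M \<in>
     {f -` A \<inter> space M | f A. f \<in> first_chaos M B \<and> A \<in> sets borel}"
    using H1_first_chaos[OF f] by blast
  moreover have "(\<lambda>w. complex_of_real (f w)) -` (Re -` A) \<inter> space M = f -` A \<inter> space M" by auto
  ultimately have "f -` A \<inter> space M \<in> stb"
    unfolding stable_field_def by (metis (no_types, lifting) sigma_sets.Basic sjoin_upper(1) subsetD)
  then show "f -` A \<inter> space (F stb) \<in> sets (F stb)"
    by (simp add: sets_F[OF stb_csub] space_F[OF stb_csub])
qed simp

lemma stb_least: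
  assumes y: "y \<in> complete_subfields M" and H: "\<And>f. f \<in> H1 \<Longrightarrow> f \<in> borel_measurable (F y)"
  shows "stb \<subseteq> y"
  unfolding stable_field_def
proof (intro join_least[OF y] triv_least[OF y])
  have "f -` A \<inter> space M \<in> y" if f: "f \<in> first_chaos M B" and A: "A \<in> sets borel" for f A
  proof -
    have "f \<in> borel_measurable (F y)"
      using H[OF first_chaos_H1(1)[OF f]] H[OF first_chaos_H1(2)[OF f]]
      by (simp add: borel_measurable_complex_iff)
    from measurable_sets[OF this A] show ?thesis by (simp add: sets_F[OF y] space_F[OF y])
  qed
  then show "sigma_sets (space M) {f -` A \<inter> space M | f A. f \<in> first_chaos M B \<and> A \<in> sets borel} \<subseteq> y"
    by (intro sigma_algebra.sigma_sets_subset[OF csubD(1)[OF y]]) blast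
qed

text \<open>
  A function in the first chaos is the sum of \<open>P x f\<close> and \<open>P (cl x) f\<close>, which are themselves in
  the first chaos; so the right-hand side already makes the whole first chaos measurable.
\<close>
lemma stb_split: assumes x: "x \<in> B" shows "stb \<subseteq> (stb \<inter> x) \<curlyvee> (stb \<inter> cl x)"
proof (rule stb_least)
  have c: "stb \<inter> x \<in> complete_subfields M" "stb \<inter> cl x \<in> complete_subfields M"
    by (fact csub_Int[OF stb_csub B_csub[OF x]] csub_Int[OF stb_csub B_csub[OF cl_B[OF x]]])+
  show c2: "(stb \<inter> x) \<curlyvee> (stb \<inter> cl x) \<in> complete_subfields M" by (rule sjoin_csub[OF c])
  fix f assume f: "f \<in> H1"
  have meas: "P z f \<in> borel_measurable (F (stb \<inter> z))" if z: "z \<in> B" for z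
    by (rule measF_Int[OF stb_csub B_csub[OF z] H1_stb[OF H1_P[OF f z]] P_meas])
  have "(\<lambda>w. P x f w + P (cl x) f w) \<in> borel_measurable (F ((stb \<inter> x) \<curlyvee> (stb \<inter> cl x)))"
    using measF_mono[OF c(1) c2 sjoin_upper(1) meas[OF x]]
      measF_mono[OF c(2) c2 sjoin_upper(2) meas[OF cl_B[OF x]]] by measurable
  then show "f \<in> borel_measurable (F ((stb \<inter> x) \<curlyvee> (stb \<inter> cl x)))"
    by (rule measF_aeq[OF c2]) (use f x in \<open>auto simp: H1_def intro: L2_meas aeq_sym\<close>)
qed

lemma commute_stb: assumes x: "x \<in> B" shows "commute (P x) (P stb)"
  unfolding commute_def
proof
  fix u assume u: "u \<in> L2"
  note * = B_csub[OF x] B_csub[OF cl_B[OF x]] cl_indep[OF x] stb_csub stb_split[OF x] u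
  show "P x (P stb u) \<doteq> P stb (P x u)"
    using P_P_split[OF *] P_P_split'[OF *] by (blast intro: aeq_trans aeq_sym)
qed

lemma proj_stb: "proj (P stb)"
  by (rule proj_P[OF stb_csub])

section \<open>Functions of finite order\<close>

text \<open>
  The operators built from the \<open>P x\<close>. Composition preserves projections only because everything
  commutes; the induction therefore carries commutation with anything that commutes with all the
  \<open>P x\<close>, which covers both the other operators of this kind and \<open>P stb\<close>.
\<close>
inductive Alg :: "(('a \<Rightarrow> real) \<Rightarrow> 'a \<Rightarrow> real) \<Rightarrow> bool" where
  Alg_id: "Alg id"
| Alg_P: "x \<in> B \<Longrightarrow> Alg (P x)"
| Alg_cop: "Alg T \<Longrightarrow> Alg (cop T)"
| Alg_comp: "Alg S \<Longrightarrow> Alg T \<Longrightarrow> Alg (S \<circ> T)"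

lemma Alg_all:
  assumes "Alg S"
  shows "proj S \<and> (\<forall>R. proj R \<and> (\<forall>x\<in>B. commute R (P x)) \<longrightarrow> commute R S)"
  using assms
proof induction
  case Alg_id show ?case by (auto simp: proj_def commute_def)
next
  case (Alg_P x) then show ?case by (simp add: proj_PB)
next
  case (Alg_cop T) then show ?case using proj_cop[of T] commute_cop[of _ T] by blast
next
  case (Alg_comp S T)
  have "commute S (P x)" if "x \<in> B" for x
    using Alg_comp.IH(1) proj_PB[OF that] commute_P[OF that] commute_sym[of "P x" S] by blast
  then have ST: "commute S T" using Alg_comp.IH by blast
  show ?case using Alg_comp.IH proj_comp[OF _ _ ST] commute_comp[of _ S T] by blast
qed

lemma Alg_proj: "Alg S \<Longrightarrow> proj S"
  using Alg_all by blast

lemma Alg_commute_P: assumes "Alg S" "x \<in> B" shows "commute S (P x)"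
  using Alg_all[OF assms(1)] proj_PB[OF assms(2)] commute_P[OF assms(2)] commute_sym[of "P x" S] by blast

lemma Alg_commute: assumes "Alg S" "Alg T" shows "commute S T"
  using Alg_all[OF assms(2)] Alg_proj[OF assms(1)] Alg_commute_P[OF assms(1)] by blast

lemma Alg_commute_stb: assumes "Alg S" shows "commute (P stb) S"
  using Alg_all[OF assms] proj_stb commute_stb[THEN commute_sym] by blast

abbreviation N :: "'a set set \<Rightarrow> ('a \<Rightarrow> real) \<Rightarrow> 'a \<Rightarrow> real" where
  "N c \<equiv> cop (P c)"

text \<open>
  In the spectral picture, \<open>Ns cs\<close> keeps the sets that meet the complement of every entry of
  \<open>cs\<close>.
\<close>
definition Ns :: "'a set set list \<Rightarrow> ('a \<Rightarrow> real) \<Rightarrow> 'a \<Rightarrow> real" where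
  "Ns cs = foldr (\<lambda>c T. N c \<circ> T) cs id"

lemma Ns_simps: "Ns [] u = u" "Ns (c # cs) u = N c (Ns cs u)"
  by (simp_all add: Ns_def)

text \<open>
  Cells are represented by their complements: \<open>c \<curlyvee> d\<close> being everything means that the cells
  \<open>cl c\<close> and \<open>cl d\<close> are disjoint.
\<close>
definition disj :: "'a set set list \<Rightarrow> bool" where
  "disj cs \<longleftrightarrow> set cs \<subseteq> B \<and> sorted_wrt (\<lambda>c d. c \<curlyvee> d = sets M) cs"

lemma Alg_N: "c \<in> B \<Longrightarrow> Alg (N c)"
  by (intro Alg_cop Alg_P)

lemma Alg_Ns: "set cs \<subseteq> B \<Longrightarrow> Alg (Ns cs)"
  by (induction cs) (auto simp: Ns_def intro!: Alg_id Alg_comp Alg_N)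

lemma aeq_0_proj: assumes "proj T" "u \<in> L2" "u \<doteq> (\<lambda>w. 0)" shows "T u \<doteq> (\<lambda>w. 0)"
  using proj_cong[OF assms(1,3,2) L2_const] proj_0[OF assms(1)] by (rule aeq_trans)

lemma commute_0:
  assumes "proj S" "commute S T" "u \<in> L2" "proj T" "T u \<doteq> (\<lambda>w. 0)" shows "T (S u) \<doteq> (\<lambda>w. 0)"
  using commuteD[OF assms(2,3)] aeq_0_proj[OF assms(1) proj_L2[OF assms(4,3)] assms(5)]
  by (blast intro: aeq_trans aeq_sym)

text \<open>
  The hypotheses on \<open>g\<close> say that it has exactly one point in the cell \<open>cl c\<close>: at least one by
  \<open>P c g \<doteq> 0\<close>, and not points in both halves of any cut by \<open>x\<close>. Integrating out everything in
  \<open>c\<close> against \<open>Z\<close> leaves a function on the cell with one point, hence in the first chaos.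
\<close>
lemma slice_H1:
  assumes g: "g \<in> L2" and c: "c \<in> B" and Pc: "P c g \<doteq> (\<lambda>w. 0)"
    and NN: "\<And>x. x \<in> B \<Longrightarrow> N (c \<curlyvee> x) (N (c \<curlyvee> cl x) g) \<doteq> (\<lambda>w. 0)"
    and Z: "Z \<in> c"
  shows "P (cl c) (\<lambda>w. indicator Z w * g w) \<in> H1"
  unfolding H1_def
proof (intro CollectI conjI ballI)
  define a where "a = cl c"
  have a: "a \<in> B" using cl_B[OF c] by (simp add: a_def)
  have ZM: "Z \<in> events" using Z csubD(2)[OF B_csub[OF c]] by blast
  have mult: "(\<lambda>w. indicator Z w * v w) \<in> L2" if "v \<in> L2" for v
    using L2_indicator_mult[OF that ZM] by (simp add: mult.commute)
  let ?gZ = "\<lambda>w. indicator Z w * g w"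
  show "P (cl c) ?gZ \<in> L2" using P_L2[OF B_csub[OF a] mult[OF g]] by (simp add: a_def)
  fix x assume x: "x \<in> B"
  have pull: "P y (P a ?gZ) \<doteq> P a (\<lambda>w. indicator Z w * P (c \<curlyvee> y) g w)" if y: "y \<in> B" for y
  proof -
    have d: "c \<curlyvee> y \<in> B" using join_B[OF c y] .
    have "a \<inter> y = a \<inter> (c \<curlyvee> y)"
    proof -
      have "a \<inter> (c \<curlyvee> y) = triv \<curlyvee> (a \<inter> y)"
        using distrib[OF a c y] cl_Int[OF c] by (simp add: a_def Int_commute)
      also have "\<dots> = a \<inter> y"
        using join_triv[OF B_csub[OF Int_B[OF a y]]] by (simp add: sjoin_commute[of M triv])
      finally show ?thesis ..
    qed
    then have "P y (P a ?gZ) \<doteq> P (a \<inter> (c \<curlyvee> y)) ?gZ"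
      using P_P[OF a y mult[OF g]] by simp
    also have "\<dots> \<doteq> P a (P (c \<curlyvee> y) ?gZ)"
      using P_P[OF d a mult[OF g]] by (simp add: Int_commute aeq_sym)
    also have "\<dots> \<doteq> P a (\<lambda>w. indicator Z w * P (c \<curlyvee> y) g w)"
    proof (rule P_cong[OF B_csub[OF a]])
      show "P (c \<curlyvee> y) ?gZ \<doteq> (\<lambda>w. indicator Z w * P (c \<curlyvee> y) g w)"
        using Z sjoin_upper(1)[of c M y]
        by (intro P_mult[OF B_csub[OF d] measF_indicator[OF B_csub[OF d]] g mult[OF g]]) auto
    qed (intro P_L2 B_csub d mult g)+
    finally show ?thesis .
  qed
  define d e where "d = c \<curlyvee> x" and "e = c \<curlyvee> cl x"
  have de: "d \<in> B" "e \<in> B" "d \<inter> e = c"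
    using join_B[OF c x] join_B[OF c cl_B[OF x]] split_cl[OF c x] by (simp_all add: d_def e_def)
  have L: "P d g \<in> L2" "P e g \<in> L2" using P_L2 B_csub de g by auto
  have "P d (g \<ominus> P e g) \<doteq> P d g \<ominus> P d (P e g)"
    by (rule proj_fdiff[OF proj_PB[OF de(1)] g L(2)])
  moreover have "P d (P e g) \<doteq> P c g" using P_P[OF de(2,1) g] de(3) by (simp add: Int_commute)
  moreover have "N d (N e g) \<doteq> (\<lambda>w. 0)" using NN[OF x] by (simp add: d_def e_def)
  ultimately have "g \<doteq> (\<lambda>w. P d g w + P e g w)"
    using Pc unfolding aeq_def cop_def fdiff_def by eventually_elim simp
  then have "?gZ \<doteq> (\<lambda>w. indicator Z w * P d g w + indicator Z w * P e g w)"
    unfolding aeq_def by eventually_elim (simp add: distrib_left[symmetric])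
  then have "P a ?gZ \<doteq> P a (\<lambda>w. indicator Z w * P d g w + indicator Z w * P e g w)"
    by (rule P_cong[OF B_csub[OF a]]) (intro L2_add mult g L)+
  also have "\<dots> \<doteq> (\<lambda>w. P a (\<lambda>w. indicator Z w * P d g w) w + P a (\<lambda>w. indicator Z w * P e g w) w)"
    by (rule proj_add[OF proj_PB[OF a]]) (intro mult L)+
  also have "\<dots> \<doteq> (\<lambda>w. P x (P a ?gZ) w + P (cl x) (P a ?gZ) w)"
    using pull[OF x] pull[OF cl_B[OF x]] unfolding aeq_def d_def e_def by eventually_elim simp
  finally show "P (cl c) ?gZ \<doteq> (\<lambda>w. P x (P (cl c) ?gZ) w + P (cl x) (P (cl c) ?gZ) w)"
    by (simp add: a_def)
qed

text \<open>
  The hypotheses of \<open>slice_H1\<close>: exactly one point in the cell \<open>cl c\<close>.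
\<close>
definition sliced :: "('a \<Rightarrow> real) \<Rightarrow> 'a set set \<Rightarrow> bool" where
  "sliced g c \<longleftrightarrow> c \<in> B \<and> P c g \<doteq> (\<lambda>w. 0) \<and>
     (\<forall>x\<in>B. N (c \<curlyvee> x) (N (c \<curlyvee> cl x) g) \<doteq> (\<lambda>w. 0))"

text \<open>
  For \<open>Z\<close> in \<open>z\<close> and \<open>A\<close> in \<open>cl c\<close>, the integral of \<open>g\<close> over \<open>Z \<inter> A\<close> is the inner product of
  the slice of \<open>g\<close> along \<open>Z\<close> with the indicator of \<open>A\<close>. The slice is in the first chaos, so this
  indicator may be replaced by its conditional expectation on the stable field, which is still
  measurable for the cell; the resulting test function is measurable for the smaller field.
\<close>
lemma slice_step:
  assumes g: "g \<in> L2" and c: "sliced g c" and z: "z \<in> complete_subfields M" "z \<subseteq> c"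
    and 0: "P (z \<curlyvee> (stb \<inter> cl c)) g \<doteq> (\<lambda>w. 0)"
  shows "P (z \<curlyvee> cl c) g \<doteq> (\<lambda>w. 0)"
proof -
  define a where "a = cl c"
  have cB: "c \<in> B" using c by (simp add: sliced_def)
  have a: "a \<in> B" using cl_B[OF cB] by (simp add: a_def)
  note ac = B_csub[OF a]
  have sa: "stb \<inter> a \<in> complete_subfields M" by (rule csub_Int[OF stb_csub ac])
  define y where "y = z \<curlyvee> (stb \<inter> a)"
  have y: "y \<in> complete_subfields M" unfolding y_def by (rule sjoin_csub[OF z(1) sa])
  have za: "z \<curlyvee> a \<in> complete_subfields M" by (rule sjoin_csub[OF z(1) ac])
  have rect: "ip g (indicator (Z \<inter> A)) = 0" if Z: "Z \<in> z" and A: "A \<in> a" for Z A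
  proof -
    have ZM: "Z \<in> events" using Z csubD(2)[OF z(1)] by blast
    have AM: "A \<in> events" using A csubD(2)[OF ac] by blast
    define gZ where "gZ = (\<lambda>w. indicator Z w * g w)"
    have gZ: "gZ \<in> L2" using L2_indicator_mult[OF g ZM] by (simp add: gZ_def mult.commute)
    have h: "P a gZ \<in> H1"
      unfolding gZ_def a_def using c z(2) Z by (intro slice_H1 g) (auto simp: sliced_def)
    define r where "r = P stb (indicator A)"
    have r: "r \<in> L2" "r \<in> borel_measurable (F stb)"
      unfolding r_def by (intro P_L2 stb_csub L2_indicator AM P_meas)+
    have "P a r \<doteq> r"
    proof -
      have "P a r \<doteq> P stb (P a (indicator A))"
        unfolding r_def using commuteD[OF commute_stb[OF a] L2_indicator[OF AM]] .
      also have "\<dots> \<doteq> r" unfolding r_def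
        by (intro P_cong stb_csub P_fix ac L2_indicator AM measF_indicator A P_L2)
      finally show ?thesis .
    qed
    then have ra: "r \<in> borel_measurable (F a)" by (rule P_fixD[OF ac r(1)])
    then have "r \<in> borel_measurable (F (stb \<inter> a))" by (rule measF_Int[OF stb_csub ac r(2)])
    then have ry: "r \<in> borel_measurable (F y)"
      unfolding y_def by (rule measF_mono[OF sa y[unfolded y_def] sjoin_upper(2)])
    let ?rZ = "\<lambda>w. r w * indicator Z w"
    have rZ: "?rZ \<in> L2" "?rZ \<in> borel_measurable (F y)"
      using L2_indicator_mult[OF r(1) ZM] ry measF_indicator[OF y, of Z] Z sjoin_upper(1)[of z M "stb \<inter> a"]
      unfolding y_def by (auto intro!: borel_measurable_times)
    have "ip g (indicator (Z \<inter> A)) = ip gZ (indicator A)"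
      by (simp add: ip_def gZ_def indicator_inter_arith mult_ac)
    also have "\<dots> = ip (P a gZ) (indicator A)"
      by (rule P_ip[OF ac gZ L2_indicator[OF AM] measF_indicator[OF ac A], symmetric])
    also have "\<dots> = ip r (P a gZ)"
      unfolding r_def by (subst ip_commute, rule P_ip[symmetric])
        (intro stb_csub L2_indicator AM H1_L2[OF h] H1_stb[OF h])+
    also have "\<dots> = ip (P a gZ) r" by (rule ip_commute)
    also have "\<dots> = ip gZ r" by (rule P_ip[OF ac gZ r(1) ra])
    also have "\<dots> = ip g ?rZ" by (simp add: ip_def gZ_def mult_ac)
    also have "\<dots> = ip (P y g) ?rZ" by (rule P_ip[OF y g rZ, symmetric])
    also have "\<dots> = ip (\<lambda>w. 0) ?rZ"
      using 0 by (intro ip_cong P_L2 y g L2_const rZ) (simp_all add: y_def a_def)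
    finally show ?thesis by (simp add: ip_0)
  qed
  have "P (z \<curlyvee> a) g \<doteq> (\<lambda>w. 0)"
    using sjoin_ip_0[OF z(1) ac g rect] by (intro P_eqI[OF za g L2_const measF_0]) (simp add: ip_0)
  then show ?thesis by (simp add: a_def)
qed

lemma P_0_mono:
  assumes "x \<in> complete_subfields M" "y \<in> complete_subfields M" "x \<subseteq> y" "g \<in> L2" "P y g \<doteq> (\<lambda>w. 0)"
  shows "P x g \<doteq> (\<lambda>w. 0)"
  using P_mono2[OF assms(1-4)] aeq_0_proj[OF proj_P[OF assms(1)] P_L2[OF assms(2,4)] assms(5)]
  by (blast intro: aeq_trans aeq_sym)

definition cl_joins :: "'a set set list \<Rightarrow> 'a set set" where
  "cl_joins cs = foldr (\<lambda>c z. cl c \<curlyvee> z) cs triv"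

definition stb_cl_joins :: "'a set set list \<Rightarrow> 'a set set" where
  "stb_cl_joins cs = foldr (\<lambda>c z. (stb \<inter> cl c) \<curlyvee> z) cs triv"

lemma cl_joins_simps: "cl_joins [] = triv" "cl_joins (c # cs) = cl c \<curlyvee> cl_joins cs"
  by (simp_all add: cl_joins_def)

lemma stb_cl_joins_simps: "stb_cl_joins [] = triv" "stb_cl_joins (c # cs) = (stb \<inter> cl c) \<curlyvee> stb_cl_joins cs"
  by (simp_all add: stb_cl_joins_def)

lemma cl_joins_B: "set cs \<subseteq> B \<Longrightarrow> cl_joins cs \<in> B"
  by (induction cs) (auto simp: cl_joins_simps intro!: triv_B join_B cl_B)

lemma stb_cl_joins_csub: "set cs \<subseteq> B \<Longrightarrow> stb_cl_joins cs \<in> complete_subfields M"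
proof (induction cs)
  case Nil then show ?case using B_csub[OF triv_B] by (simp add: stb_cl_joins_simps)
next
  case (Cons c cs)
  then show ?case unfolding stb_cl_joins_simps
    by (intro sjoin_csub csub_Int stb_csub B_csub[OF cl_B]) auto
qed

lemma stb_cl_joins_stb: "stb_cl_joins cs \<subseteq> stb"
proof (induction cs)
  case Nil show ?case unfolding stb_cl_joins_simps by (rule triv_least[OF stb_csub])
next
  case (Cons c cs)
  show ?case unfolding stb_cl_joins_simps by (rule join_least[OF stb_csub Int_lower1 Cons])
qed

lemma stb_cl_joins_le:
  assumes "c \<in> B" "set ds \<subseteq> B" "\<forall>d\<in>set ds. c \<curlyvee> d = sets M" shows "stb_cl_joins ds \<subseteq> c"
  using assms(2,3)
proof (induction ds)
  case Nil then show ?case using triv_least[OF B_csub[OF assms(1)]] by (simp add: stb_cl_joins_simps)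
next
  case (Cons d ds)
  then show ?case unfolding stb_cl_joins_simps
    using cl_le[OF assms(1), of d] by (intro join_least B_csub assms(1)) auto
qed

text \<open>
  One cell after the other is enlarged from its stable part to all of it; at each step the other
  cells, whether enlarged already or not, lie inside the complement \<open>d\<close> of the current one.
\<close>
lemma slice_all:
  assumes g: "g \<in> L2" and "disj ds" "\<forall>d\<in>set ds. sliced g d"
    and "z \<in> complete_subfields M" "\<forall>d\<in>set ds. z \<subseteq> d"
    and "P (z \<curlyvee> stb_cl_joins ds) g \<doteq> (\<lambda>w. 0)"
  shows "P (z \<curlyvee> cl_joins ds) g \<doteq> (\<lambda>w. 0)"
  using assms(2-)
proof (induction ds arbitrary: z)
  case Nil
  then show ?case by (simp add: cl_joins_simps stb_cl_joins_simps)
next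
  case (Cons d ds)
  have dB: "d \<in> B" "set ds \<subseteq> B" and dj: "disj ds" and dd: "\<forall>e\<in>set ds. d \<curlyvee> e = sets M"
    using Cons.prems(1) by (auto simp: disj_def)
  have k: "stb_cl_joins ds \<in> complete_subfields M" by (rule stb_cl_joins_csub[OF dB(2)])
  have cd: "cl d \<in> complete_subfields M" by (rule B_csub[OF cl_B[OF dB(1)]])
  have sd: "stb \<inter> cl d \<in> complete_subfields M" by (rule csub_Int[OF stb_csub cd])
  note z = Cons.prems(3)
  have z1: "z \<curlyvee> stb_cl_joins ds \<in> complete_subfields M" by (rule sjoin_csub[OF z k])
  have z2: "z \<curlyvee> cl d \<in> complete_subfields M" by (rule sjoin_csub[OF z cd])
  have "P ((z \<curlyvee> stb_cl_joins ds) \<curlyvee> (stb \<inter> cl d)) g \<doteq> (\<lambda>w. 0)"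
  proof (rule P_0_mono[OF _ _ _ g Cons.prems(5)])
    show c1: "z \<curlyvee> stb_cl_joins (d # ds) \<in> complete_subfields M"
      unfolding stb_cl_joins_simps by (intro sjoin_csub z k sd)
    show "z \<curlyvee> stb_cl_joins ds \<curlyvee> (stb \<inter> cl d) \<in> complete_subfields M" by (rule sjoin_csub[OF z1 sd])
    show "z \<curlyvee> stb_cl_joins ds \<curlyvee> (stb \<inter> cl d) \<subseteq> z \<curlyvee> stb_cl_joins (d # ds)"
      using c1 unfolding stb_cl_joins_simps
      by (intro join_least order_trans[OF _ sjoin_upper(2)[where x=z]] sjoin_upper) auto
  qed
  then have "P ((z \<curlyvee> stb_cl_joins ds) \<curlyvee> cl d) g \<doteq> (\<lambda>w. 0)"
    using Cons.prems dB dd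
    by (intro slice_step[OF g _ z1] join_least B_csub stb_cl_joins_le) auto
  then have "P ((z \<curlyvee> cl d) \<curlyvee> stb_cl_joins ds) g \<doteq> (\<lambda>w. 0)"
  proof (rule P_0_mono[OF _ _ _ g, rotated 3])
    show "z \<curlyvee> cl d \<curlyvee> stb_cl_joins ds \<in> complete_subfields M" by (rule sjoin_csub[OF z2 k])
    show c1: "z \<curlyvee> stb_cl_joins ds \<curlyvee> cl d \<in> complete_subfields M" by (rule sjoin_csub[OF z1 cd])
    show "z \<curlyvee> cl d \<curlyvee> stb_cl_joins ds \<subseteq> z \<curlyvee> stb_cl_joins ds \<curlyvee> cl d"
      by (intro join_least c1 sjoin_upper order_trans[OF _ sjoin_upper(1)[where y="cl d"]])
  qed
  then have "P ((z \<curlyvee> cl d) \<curlyvee> cl_joins ds) g \<doteq> (\<lambda>w. 0)"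
  proof (intro Cons.IH dj z2)
    show "\<forall>e\<in>set ds. sliced g e" using Cons.prems(2) by simp
    show "\<forall>e\<in>set ds. z \<curlyvee> cl d \<subseteq> e"
    proof
      fix e assume e: "e \<in> set ds"
      have "cl d \<subseteq> e" using e dd dB by (intro cl_le) (auto simp: sjoin_commute[of M e])
      then show "z \<curlyvee> cl d \<subseteq> e" using e dB Cons.prems(4) by (intro join_least B_csub) auto
    qed
  qed
  then show ?case
  proof (rule P_0_mono[OF _ _ _ g, rotated 3])
    have cc: "cl_joins ds \<in> complete_subfields M" by (rule B_csub[OF cl_joins_B[OF dB(2)]])
    show c1: "z \<curlyvee> cl d \<curlyvee> cl_joins ds \<in> complete_subfields M" by (rule sjoin_csub[OF z2 cc])
    show "z \<curlyvee> cl_joins (d # ds) \<in> complete_subfields M"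
      unfolding cl_joins_simps by (intro sjoin_csub z cc cd)
    show "z \<curlyvee> cl_joins (d # ds) \<subseteq> z \<curlyvee> cl d \<curlyvee> cl_joins ds"
      unfolding cl_joins_simps
      by (intro join_least c1 sjoin_upper order_trans[OF _ sjoin_upper(1)[where y="cl_joins ds"]])
  qed
qed

lemma Ns_append: "Ns (as @ bs) u = Ns as (Ns bs u)"
  by (induction as) (simp_all add: Ns_simps)

lemma Ns_move:
  assumes "set as \<subseteq> B" "c \<in> B" "set bs \<subseteq> B" "u \<in> L2"
  shows "Ns (as @ c # bs) u \<doteq> N c (Ns (as @ bs) u)"
  using commuteD[OF Alg_commute[OF Alg_Ns[OF assms(1)] Alg_N[OF assms(2)]]
      proj_L2[OF Alg_proj[OF Alg_Ns[OF assms(3)]] assms(4)]]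
  by (simp add: Ns_append Ns_simps)

lemma Ns_L2: "set cs \<subseteq> B \<Longrightarrow> u \<in> L2 \<Longrightarrow> Ns cs u \<in> L2"
  using proj_L2[OF Alg_proj[OF Alg_Ns]] by blast

lemma P_Ns_0:
  assumes "c \<in> set cs" "set cs \<subseteq> B" "u \<in> L2" shows "P c (Ns cs u) \<doteq> (\<lambda>w. 0)"
  using assms(1,2)
proof (induction cs)
  case (Cons d cs)
  have cB: "c \<in> B" "d \<in> B" "set cs \<subseteq> B" using Cons.prems by auto
  have L: "Ns cs u \<in> L2" using Ns_L2[OF cB(3) assms(3)] .
  show ?case
  proof (cases "c = d")
    case True
    then show ?thesis using proj_proj_cop[OF proj_PB[OF cB(2)] L] by (simp add: Ns_simps)
  next
    case False
    then have "P c (Ns cs u) \<doteq> (\<lambda>w. 0)" using Cons by auto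
    then show ?thesis unfolding Ns_simps
      by (rule commute_0[OF Alg_proj[OF Alg_N[OF cB(2)]] Alg_commute_P[OF Alg_N[OF cB(2)] cB(1)] L proj_PB[OF cB(1)]])
  qed
qed simp

lemma cl_joins_upper: "c \<in> set cs \<Longrightarrow> set cs \<subseteq> B \<Longrightarrow> cl c \<subseteq> cl_joins cs"
proof (induction cs)
  case (Cons d cs)
  then show ?case unfolding cl_joins_simps
    using sjoin_upper(1)[of "cl d" M "cl_joins cs"] sjoin_upper(2)[of "cl_joins cs" M "cl d"] by auto
qed simp

text \<open>
  Induction on \<open>n\<close>. For \<open>n\<close> cells, \<open>g = Ns cs v\<close> has exactly one point in each of them, since
  cutting a cell produces \<open>n + 1\<close> cells, and no point outside, since the outside is a further
  cell. So \<open>g\<close> is measurable for the join of the cells, where \<open>slice_all\<close> shows that it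
  vanishes; thus already \<open>n\<close> factors kill \<open>v\<close>.
\<close>
lemma finite_level_vanish:
  assumes v: "v \<in> L2" "P stb v \<doteq> (\<lambda>w. 0)"
    and "\<And>cs. disj cs \<Longrightarrow> length cs = n \<Longrightarrow> Ns cs v \<doteq> (\<lambda>w. 0)"
  shows "v \<doteq> (\<lambda>w. 0)"
  using assms(3)
proof (induction n)
  case 0
  from 0[of "[]"] show ?case by (simp add: disj_def Ns_simps)
next
  case (Suc n)
  show ?case
  proof (rule Suc.IH)
    fix cs assume cs: "disj cs" "length cs = n"
    define g where "g = Ns cs v"
    have csB: "set cs \<subseteq> B" using cs by (simp add: disj_def)
    have g: "g \<in> L2" unfolding g_def by (rule Ns_L2[OF csB v(1)])
    have sl: "sliced g c" if c: "c \<in> set cs" for c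
      unfolding sliced_def
    proof (intro conjI ballI)
      show cB: "c \<in> B" using c csB by blast
      show "P c g \<doteq> (\<lambda>w. 0)" unfolding g_def by (rule P_Ns_0[OF c csB v(1)])
      fix x assume x: "x \<in> B"
      obtain as bs where sp: "cs = as @ c # bs" using split_list[OF c] by blast
      have ab: "set as \<subseteq> B" "set bs \<subseteq> B" "set (as @ bs) \<subseteq> B" using csB sp by auto
      let ?d = "c \<curlyvee> x" and ?e = "c \<curlyvee> cl x" and ?w = "Ns (as @ bs) v"
      have de: "?d \<in> B" "?e \<in> B" using join_B cB x cl_B by auto
      have w: "?w \<in> L2" by (rule Ns_L2[OF ab(3) v(1)])
      have "disj (?d # ?e # as @ bs)"
      proof -
        have j: "c \<curlyvee> b = sets M" if "b \<in> set (as @ bs)" for b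
          using cs(1) that unfolding sp disj_def by (auto simp: sorted_wrt_append sjoin_commute[of M c b])
        have "(c \<curlyvee> y) \<curlyvee> b = sets M" if "b \<in> set (as @ bs)" "y \<in> B" for b y
          using j[OF that(1)] that ab(3)
          by (intro join_top_mono[OF _ sjoin_upper(1) order_refl] B_csub join_B cB) auto
        moreover have "?d \<curlyvee> ?e = sets M"
          using cl_join[OF x] by (intro join_top_mono[OF _ sjoin_upper(2) sjoin_upper(2)] B_csub de)
        moreover have "sorted_wrt (\<lambda>c d. c \<curlyvee> d = sets M) (as @ bs)"
          using cs(1) by (auto simp: disj_def sp sorted_wrt_append)
        ultimately show ?thesis using x cl_B[OF x] ab de by (auto simp: disj_def)
      qed
      moreover have "length (?d # ?e # as @ bs) = Suc n" using cs(2) sp by simp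
      ultimately have 0: "N ?d (N ?e ?w) \<doteq> (\<lambda>w. 0)" using Suc.prems[of "?d # ?e # as @ bs"] by (simp add: Ns_simps)
      have T: "Alg (N ?d \<circ> N ?e)" by (intro Alg_comp Alg_N de)
      have gw: "g \<doteq> N c ?w" unfolding g_def sp by (rule Ns_move[OF ab(1) cB ab(2) v(1)])
      have Nw: "N c ?w \<in> L2" by (rule cop_L2[OF proj_PB[OF cB] w])
      have "(N ?d \<circ> N ?e) g \<doteq> (N ?d \<circ> N ?e) (N c ?w)"
        by (rule proj_cong[OF Alg_proj[OF T] gw g Nw])
      also have "\<dots> \<doteq> (\<lambda>w. 0)"
        by (rule commute_0[OF Alg_proj[OF Alg_N[OF cB]] Alg_commute[OF Alg_N[OF cB] T] w Alg_proj[OF T]])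
           (use 0 in simp)
      finally show "N ?d (N ?e g) \<doteq> (\<lambda>w. 0)" by simp
    qed
    have tc: "triv \<in> complete_subfields M" by (rule B_csub[OF triv_B])
    have eB: "cl_joins cs \<in> B" by (rule cl_joins_B[OF csB])
    have "P stb g \<doteq> (\<lambda>w. 0)" unfolding g_def
      by (rule commute_0[OF Alg_proj[OF Alg_Ns[OF csB]] commute_sym[OF Alg_commute_stb[OF Alg_Ns[OF csB]]] v(1) proj_stb v(2)])
    then have "P (triv \<curlyvee> stb_cl_joins cs) g \<doteq> (\<lambda>w. 0)"
      by (rule P_0_mono[OF _ stb_csub _ g, rotated 2])
         (intro sjoin_csub tc stb_cl_joins_csub csB join_least stb_csub stb_cl_joins_stb triv_least[OF stb_csub])+
    then have "P (triv \<curlyvee> cl_joins cs) g \<doteq> (\<lambda>w. 0)"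
      using sl csB triv_least[OF B_csub] by (intro slice_all[OF g cs(1)] tc) auto
    then have P0: "P (cl_joins cs) g \<doteq> (\<lambda>w. 0)"
      by (rule P_0_mono[OF B_csub[OF eB] sjoin_csub[OF tc B_csub[OF eB]] sjoin_upper(2) g])
    have "c \<curlyvee> cl_joins cs = sets M" if "c \<in> set cs" for c
    proof -
      have cB: "c \<in> B" using that csB by blast
      show ?thesis
        by (rule join_top_mono[OF cl_join[OF cB] order_refl cl_joins_upper[OF that csB] B_csub[OF cB] B_csub[OF eB]])
    qed
    then have "disj (cs @ [cl_joins cs])"
      using cs(1) eB by (auto simp: disj_def sorted_wrt_append)
    then have "Ns (cs @ [cl_joins cs]) v \<doteq> (\<lambda>w. 0)" using Suc.prems cs(2) by simp
    moreover have "Ns (cs @ [cl_joins cs]) v \<doteq> N (cl_joins cs) g"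
      using Ns_move[OF csB eB _ v(1), of "[]"] by (simp add: g_def)
    ultimately have "N (cl_joins cs) g \<doteq> (\<lambda>w. 0)" by (blast intro: aeq_trans aeq_sym)
    then have "P (cl_joins cs) g \<doteq> g" by (simp add: cop_eq_0)
    then have "g \<doteq> (\<lambda>w. 0)" using P0 by (blast intro: aeq_trans aeq_sym)
    then show "Ns cs v \<doteq> (\<lambda>w. 0)" by (simp add: g_def)
  qed
qed

end

section \<open>Completeness and approximation at finite order\<close>

context prob_space
begin

lemma nsq_diff_commute: "nsq (u \<ominus> v) = nsq (v \<ominus> u)"
  by (simp add: nsq_def ip_def fdiff_def algebra_simps)

lemma nsq_integral: "nsq u = (\<integral>w. (u w)\<^sup>2 \<partial>M)"
  by (simp add: nsq_def ip_def power2_eq_square)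

lemma nn_integral_sq: "u \<in> L2 \<Longrightarrow> (\<integral>\<^sup>+ w. ennreal ((u w)\<^sup>2) \<partial>M) = ennreal (nsq u)"
  unfolding nsq_integral by (rule nn_integral_eq_integral[OF L2_sq]) auto

lemma integral_abs_le: assumes "u \<in> L2" shows "(\<integral>w. \<bar>u w\<bar> \<partial>M) \<le> sqrt (nsq u)"
proof -
  have a: "(\<lambda>w. \<bar>u w\<bar>) \<in> L2"
    using L2_meas[OF assms] by (intro L2_bound[OF assms]) auto
  have "(\<integral>w. \<bar>u w\<bar> \<partial>M) = ip (\<lambda>w. \<bar>u w\<bar>) (\<lambda>w. 1)" by (simp add: ip_def)
  also have "\<dots> \<le> sqrt (nsq (\<lambda>w. \<bar>u w\<bar>)) * sqrt (nsq (\<lambda>w. 1))"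
    by (rule ip_le_sqrt[OF a L2_const])
  also have "\<dots> = sqrt (nsq u)" by (simp add: nsq_integral prob_space)
  finally show ?thesis .
qed

text \<open>
  The fast rate makes the increments summable in the mean, hence almost everywhere, which gives a
  pointwise limit; Fatou's lemma identifies it as the limit in the mean square.
\<close>
lemma L2_complete:
  assumes h: "\<And>n. h n \<in> L2" and fast: "\<And>n. nsq (h n \<ominus> h (Suc n)) \<le> (1/4)^n"
  shows "\<exists>k\<in>L2. (\<lambda>n. nsq (h n \<ominus> k)) \<longlonglongrightarrow> 0"
proof -
  let ?d = "\<lambda>n. h n \<ominus> h (Suc n)"
  have d: "?d n \<in> L2" for n by (intro L2_fdiff h)
  have sq: "sqrt (nsq (?d n)) \<le> (1/2)^n" for n
  proof -
    have "sqrt (nsq (?d n)) \<le> sqrt ((1/4)^n)" using fast by (rule real_sqrt_le_mono)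
    also have "\<dots> = (1/2)^n" by (simp add: real_sqrt_power real_sqrt_divide)
    finally show ?thesis .
  qed
  have hm: "h n \<in> borel_measurable M" for n by (rule L2_meas[OF h])
  have dm: "?d n \<in> borel_measurable M" for n by (rule L2_meas[OF d])
  have "(\<integral>\<^sup>+ w. (\<Sum>n. ennreal \<bar>?d n w\<bar>) \<partial>M) = (\<Sum>n. \<integral>\<^sup>+ w. ennreal \<bar>?d n w\<bar> \<partial>M)"
    using dm by (intro nn_integral_suminf) measurable
  also have "\<dots> \<le> (\<Sum>n. ennreal ((1/2)^n))"
  proof (intro suminf_le summableI)
    fix n
    have "(\<integral>\<^sup>+ w. ennreal \<bar>?d n w\<bar> \<partial>M) = ennreal (\<integral>w. \<bar>?d n w\<bar> \<partial>M)"
      by (intro nn_integral_eq_integral integrable_abs L2_integrable d) auto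
    also have "\<dots> \<le> ennreal ((1/2)^n)" using integral_abs_le[OF d] sq by (intro ennreal_leI) (rule order_trans)
    finally show "(\<integral>\<^sup>+ w. ennreal \<bar>?d n w\<bar> \<partial>M) \<le> ennreal ((1/2)^n)" .
  qed
  also have "\<dots> = ennreal (\<Sum>n. (1/2)^n)" by (intro suminf_ennreal2 summable_geometric) auto
  also have "\<dots> < top" by simp
  finally have "AE w in M. (\<Sum>n. ennreal \<bar>?d n w\<bar>) \<noteq> \<infinity>"
    using dm by (intro nn_integral_PInf_AE borel_measurable_suminf_order) (auto simp: top_unique)
  then have conv: "AE w in M. convergent (\<lambda>n. h n w)"
  proof eventually_elim
    case (elim w)
    then have "summable (\<lambda>n. \<bar>?d n w\<bar>)"
      by (intro summable_suminf_not_top) auto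
    then have "summable (\<lambda>n. h n w - h (Suc n) w)"
      unfolding fdiff_def by (rule summable_rabs_cancel)
    then have "summable (\<lambda>n. h (Suc n) w - h n w)"
      using summable_minus[of "\<lambda>n. h n w - h (Suc n) w"] by simp
    then have "convergent (\<lambda>n. \<Sum>i<n. h (Suc i) w - h i w)"
      by (simp add: summable_iff_convergent)
    then have "convergent (\<lambda>n. h n w - h 0 w)" by (simp add: sum_lessThan_telescope[of "\<lambda>n. h n w"])
    then show ?case using convergent_diff_const_right_iff[of "\<lambda>n. h n w" "h 0 w"] by simp
  qed
  define k where "k = (\<lambda>w. lim (\<lambda>n. h n w))"
  have km: "k \<in> borel_measurable M" unfolding k_def by (rule borel_measurable_lim_metric[OF hm])
  have lim: "AE w in M. (\<lambda>n. h n w) \<longlonglongrightarrow> k w"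
    using conv by eventually_elim (simp add: k_def convergent_LIMSEQ_iff)
  have dist: "sqrt (nsq (h n \<ominus> h (n + j))) \<le> 2 * (1/2)^n - 2 * (1/2)^(n+j)" for n j
  proof (induction j)
    case 0
    then show ?case by (simp add: nsq_def ip_def fdiff_def)
  next
    case (Suc j)
    have "sqrt (nsq (h n \<ominus> h (n + Suc j))) \<le> sqrt (nsq (h n \<ominus> h (n + j))) + sqrt (nsq (?d (n + j)))"
      using sqrt_nsq_triangle[OF h h h, of n "n + Suc j" "n + j"] by simp
    also have "\<dots> \<le> 2 * (1/2)^n - 2 * (1/2)^(n+j) + (1/2)^(n+j)" using Suc sq by (intro add_mono)
    finally show ?case by simp
  qed
  have bound: "nsq (h n \<ominus> h m) \<le> 4 * (1/4)^n" if nm: "n \<le> m" for n m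
  proof -
    have "sqrt (nsq (h n \<ominus> h m)) \<le> 2 * (1/2)^n"
    proof -
      have "(0::real) \<le> (1/2)^m" by simp
      moreover have "sqrt (nsq (h n \<ominus> h m)) \<le> 2 * (1/2)^n - 2 * (1/2)^m"
        using dist[of n "m - n"] nm by simp
      ultimately show ?thesis by linarith
    qed
    then have "(sqrt (nsq (h n \<ominus> h m)))\<^sup>2 \<le> (2 * (1/2)^n)\<^sup>2"
      by (intro power_mono) (auto simp: nsq_nonneg)
    moreover have "((1/2)^n)\<^sup>2 = (1/4 :: real)^n"
      unfolding power2_eq_square power_mult_distrib[symmetric] by simp
    ultimately show ?thesis by (simp only: real_sqrt_pow2[OF nsq_nonneg] power_mult_distrib) simp
  qed
  have fatou: "(\<integral>\<^sup>+ w. ennreal ((h n w - k w)\<^sup>2) \<partial>M) \<le> ennreal (4 * (1/4)^n)" for n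
  proof -
    have "(\<integral>\<^sup>+ w. ennreal ((h n w - k w)\<^sup>2) \<partial>M) = (\<integral>\<^sup>+ w. liminf (\<lambda>m. ennreal ((h n w - h m w)\<^sup>2)) \<partial>M)"
    proof (rule nn_integral_cong_AE)
      show "AE w in M. ennreal ((h n w - k w)\<^sup>2) = liminf (\<lambda>m. ennreal ((h n w - h m w)\<^sup>2))"
        using lim
      proof eventually_elim
        case (elim w)
        have "(\<lambda>m. ennreal ((h n w - h m w)\<^sup>2)) \<longlonglongrightarrow> ennreal ((h n w - k w)\<^sup>2)"
          by (intro tendsto_ennrealI tendsto_power tendsto_diff tendsto_const elim)
        from lim_imp_Liminf[OF _ this] show ?case by simp
      qed
    qed
    also have "\<dots> \<le> liminf (\<lambda>m. \<integral>\<^sup>+ w. ennreal ((h n w - h m w)\<^sup>2) \<partial>M)"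
      using hm by (intro nn_integral_liminf) measurable
    also have "\<dots> \<le> limsup (\<lambda>m. \<integral>\<^sup>+ w. ennreal ((h n w - h m w)\<^sup>2) \<partial>M)"
      by (intro Liminf_le_Limsup) simp
    also have "\<dots> \<le> ennreal (4 * (1/4)^n)"
    proof (rule Limsup_bounded)
      show "\<forall>\<^sub>F m in sequentially. (\<integral>\<^sup>+ w. ennreal ((h n w - h m w)\<^sup>2) \<partial>M) \<le> ennreal (4 * (1/4)^n)"
        using eventually_ge_at_top[of n]
      proof eventually_elim
        case (elim m)
        have "(\<integral>\<^sup>+ w. ennreal ((h n w - h m w)\<^sup>2) \<partial>M) = ennreal (nsq (h n \<ominus> h m))"
          using nn_integral_sq[OF L2_fdiff[OF h h, of n m]] by (simp add: fdiff_def)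
        then show ?case using bound[OF elim] by (simp add: ennreal_leI)
      qed
    qed
    finally show ?thesis .
  qed
  have dk: "h n \<ominus> k \<in> L2" for n
  proof (rule L2_I)
    show "h n \<ominus> k \<in> borel_measurable M"
      unfolding fdiff_def using hm km by measurable
    then show "integrable M (\<lambda>w. ((h n \<ominus> k) w)\<^sup>2)"
      using le_less_trans[OF fatou[of n] ennreal_less_top]
      by (intro integrableI_bounded) (auto simp: fdiff_def)
  qed
  have "nsq (h n \<ominus> k) \<le> 4 * (1/4)^n" for n
  proof -
    have "ennreal (nsq (h n \<ominus> k)) \<le> ennreal (4 * (1/4)^n)"
      using fatou[of n] nn_integral_sq[OF dk[of n]] by (simp add: fdiff_def)
    then show ?thesis by (simp add: ennreal_le_iff)
  qed
  then have le: "\<forall>\<^sub>F n in sequentially. norm (nsq (h n \<ominus> k)) \<le> 4 * (1/4)^n"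
    by (simp add: nsq_nonneg)
  have "(\<lambda>n. 4 * (1/4::real)^n) \<longlonglongrightarrow> 0"
    by (intro tendsto_mult_right_zero LIMSEQ_power_zero) simp
  with le have "(\<lambda>n. nsq (h n \<ominus> k)) \<longlonglongrightarrow> 0"
    by (rule Lim_null_comparison)
  moreover have "k \<in> L2"
    using L2_fdiff[OF h[of 0] dk[of 0]] by (simp add: fdiff_def)
  ultimately show ?thesis by blast
qed

lemma proj_near:
  assumes T: "proj T" and u: "u \<in> L2" and v: "v \<in> L2"
  shows "nsq (T u) \<le> 2 * nsq (u \<ominus> v) + 2 * nsq (T v)"
proof -
  have L: "T u \<in> L2" "T v \<in> L2" using proj_L2[OF T] u v by auto
  have "nsq (T u) = nsq (T u \<ominus> (\<lambda>w. 0))" by (simp add: fdiff_def)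
  also have "\<dots> \<le> 2 * nsq (T u \<ominus> T v) + 2 * nsq (T v \<ominus> (\<lambda>w. 0))"
    by (intro nsq_triangle2 L L2_const)
  also have "nsq (T u \<ominus> T v) = nsq (T (u \<ominus> v))"
    using proj_fdiff[OF T u v] L proj_L2[OF T L2_fdiff[OF u v]]
    by (intro nsq_cong L2_fdiff) (auto intro: aeq_sym)
  also have "\<dots> \<le> nsq (u \<ominus> v)" by (rule nsq_proj_le[OF T L2_fdiff[OF u v]])
  finally show ?thesis by (simp add: fdiff_def)
qed

lemma proj_lim_0:
  assumes T: "proj T" and h: "\<And>n. h n \<in> L2" "k \<in> L2" "(\<lambda>n. nsq (h n \<ominus> k)) \<longlonglongrightarrow> 0"
    and 0: "(\<lambda>n. nsq (T (h n))) \<longlonglongrightarrow> 0"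
  shows "T k \<doteq> (\<lambda>w. 0)"
proof -
  have "nsq (T k) \<le> 2 * nsq (h n \<ominus> k) + 2 * nsq (T (h n))" for n
    using proj_near[OF T h(2) h(1)[of n]] nsq_diff_commute[of k "h n"] by simp
  moreover have "(\<lambda>n. 2 * nsq (h n \<ominus> k) + 2 * nsq (T (h n))) \<longlonglongrightarrow> 2 * 0 + 2 * 0"
    by (intro tendsto_intros h(3) 0)
  ultimately have "nsq (T k) \<le> 0" by (intro LIMSEQ_le_const[of _ 0]) auto
  then show ?thesis using nsq_nonneg[of "T k"] nsq_eq_0[OF proj_L2[OF T h(2)]] by simp
qed

end

context noise
begin

text \<open>
  In the spectral picture, \<open>Z As\<close> keeps the sets that miss some cell of each list in \<open>As\<close>.
\<close>
definition Z :: "'a set set list list \<Rightarrow> ('a \<Rightarrow> real) \<Rightarrow> 'a \<Rightarrow> real" where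
  "Z As = foldr (\<lambda>cs T. cop (Ns cs) \<circ> T) As id"

lemma Z_simps: "Z [] u = u" "Z (cs # As) u = cop (Ns cs) (Z As u)"
  by (simp_all add: Z_def)

lemma Z_append: "Z (As @ Bs) u = Z As (Z Bs u)"
  by (induction As) (simp_all add: Z_simps)

definition tuples :: "nat \<Rightarrow> 'a set set list set" where
  "tuples n = {cs. disj cs \<and> length cs = n}"

lemma tuples_B: "cs \<in> tuples n \<Longrightarrow> set cs \<subseteq> B"
  by (simp add: tuples_def disj_def)

lemma Alg_Z: "set As \<subseteq> tuples n \<Longrightarrow> Alg (Z As)"
  by (induction As) (auto simp: Z_def intro!: Alg_id Alg_comp Alg_cop Alg_Ns dest: tuples_B)

text \<open>
  The projections \<open>Z As\<close> decrease as \<open>As\<close> grows. Along a minimizing sequence of lists, each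
  extending the previous one, \<open>Z As g\<close> converges. Minimality forces the limit to be killed by
  every \<open>Ns cs\<close> with \<open>n\<close> factors, and \<open>P stb\<close> still kills it, so it is zero by
  \<open>finite_level_vanish\<close>.
\<close>
lemma Z_small:
  assumes g: "g \<in> L2" "P stb g \<doteq> (\<lambda>w. 0)" and "e > 0"
  shows "\<exists>As. set As \<subseteq> tuples n \<and> nsq (Z As g) \<le> e"
proof -
  define S where "S = {nsq (Z As g) | As. set As \<subseteq> tuples n}"
  have bdd: "bdd_below S" unfolding S_def by (rule bdd_belowI[of _ 0]) (auto simp: nsq_nonneg)
  have ne: "S \<noteq> {}" unfolding S_def using empty_subsetI[of "tuples n"] by (auto intro: exI[of _ "[]"])
  define c where "c = Inf S"
  have c_le: "c \<le> nsq (Z As g)" if "set As \<subseteq> tuples n" for As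
    unfolding c_def by (rule cInf_lower[OF _ bdd]) (use that in \<open>auto simp: S_def\<close>)
  have "\<exists>As. set As \<subseteq> tuples n \<and> nsq (Z As g) < c + (1/4)^m" for m :: nat
  proof -
    have "\<exists>s\<in>S. s < c + (1/4)^m" unfolding c_def by (intro cInf_lessD ne) simp
    then show ?thesis by (auto simp: S_def)
  qed
  then obtain A where A: "\<And>m. set (A m) \<subseteq> tuples n" "\<And>m::nat. nsq (Z (A m) g) < c + (1/4)^m" by metis
  define L where "L = rec_nat (A 0) (\<lambda>m r. A (Suc m) @ r)"
  have L_simps: "L 0 = A 0" "L (Suc m) = A (Suc m) @ L m" for m by (simp_all add: L_def)
  have LT: "set (L m) \<subseteq> tuples n" for m by (induction m) (use A(1) in \<open>simp_all add: L_simps\<close>)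
  define h where "h m = Z (L m) g" for m
  have h: "h m \<in> L2" for m unfolding h_def by (rule proj_L2[OF Alg_proj[OF Alg_Z[OF LT]] g(1)])
  have up: "nsq (h m) \<le> c + (1/4)^m" for m
  proof (cases m)
    case 0 then show ?thesis using A(2)[of 0] by (simp add: h_def L_simps)
  next
    case (Suc k)
    note Z = Alg_Z[OF A(1)[of m]] Alg_Z[OF LT[of k]]
    have ZL: "Z (A m) g \<in> L2" "Z (A m) (h k) \<in> L2" "Z (L k) (Z (A m) g) \<in> L2"
      using proj_L2[OF Alg_proj[OF Z(1)]] proj_L2[OF Alg_proj[OF Z(2)]] g(1) h by auto
    have "nsq (h m) = nsq (Z (L k) (Z (A m) g))"
      using commuteD[OF Alg_commute[OF Z] g(1)] ZL
      by (intro nsq_cong) (auto simp: h_def L_simps Suc Z_append)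
    also have "\<dots> \<le> nsq (Z (A m) g)" by (rule nsq_proj_le[OF Alg_proj[OF Z(2)] ZL(1)])
    finally show ?thesis using A(2)[of m] by simp
  qed
  have "nsq (h m \<ominus> h (Suc m)) \<le> (1/4)^m" for m
  proof -
    have "h (Suc m) = Z (A (Suc m)) (h m)" by (simp add: h_def L_simps Z_append)
    then have "nsq (h m) = nsq (h (Suc m)) + nsq (h m \<ominus> h (Suc m))"
      using nsq_proj_cop[OF Alg_proj[OF Alg_Z[OF A(1)[of "Suc m"]]] h[of m]] by (simp add: cop_def)
    then show ?thesis using up[of m] c_le[OF LT[of "Suc m"]] by (simp add: h_def)
  qed
  then obtain k where k: "k \<in> L2" "(\<lambda>m. nsq (h m \<ominus> k)) \<longlonglongrightarrow> 0"
    using L2_complete[of h] h by blast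
  have pow: "(\<lambda>m. (1/4::real)^m) \<longlonglongrightarrow> 0" by (intro LIMSEQ_power_zero) simp
  have "k \<doteq> (\<lambda>w. 0)"
  proof (rule finite_level_vanish[OF k(1)])
    show "P stb k \<doteq> (\<lambda>w. 0)"
    proof (rule proj_lim_0[OF proj_stb h k])
      have "P stb (h m) \<doteq> (\<lambda>w. 0)" for m unfolding h_def
        by (rule commute_0[OF Alg_proj[OF Alg_Z[OF LT]] commute_sym[OF Alg_commute_stb[OF Alg_Z[OF LT]]] g(1) proj_stb g(2)])
      then have "nsq (P stb (h m)) = 0" for m
        using nsq_eq_0[OF proj_L2[OF proj_stb h[of m]]] by simp
      then show "(\<lambda>m. nsq (P stb (h m))) \<longlonglongrightarrow> 0" by simp
    qed
    fix cs assume cs: "disj cs" "length cs = n"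
    then have ct: "cs \<in> tuples n" by (simp add: tuples_def)
    note pN = Alg_proj[OF Alg_Ns[OF tuples_B[OF ct]]]
    show "Ns cs k \<doteq> (\<lambda>w. 0)"
    proof (rule proj_lim_0[OF pN h k])
      have "nsq (Ns cs (h m)) \<le> (1/4)^m" for m
      proof -
        have "nsq (h m) = nsq (Ns cs (h m)) + nsq (Z (cs # L m) g)"
          using nsq_proj_cop[OF pN h[of m]] by (simp add: Z_simps h_def)
        moreover have "c \<le> nsq (Z (cs # L m) g)" using ct LT[of m] by (intro c_le) auto
        ultimately show ?thesis using up[of m] by simp
      qed
      then have "\<forall>\<^sub>F m in sequentially. norm (nsq (Ns cs (h m))) \<le> (1/4)^m"
        by (simp add: nsq_nonneg)
      then show "(\<lambda>m. nsq (Ns cs (h m))) \<longlonglongrightarrow> 0"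
        by (rule Lim_null_comparison[OF _ pow])
    qed
  qed
  then have "nsq (h m \<ominus> k) = nsq (h m)" for m
    using h k(1) by (intro nsq_cong L2_fdiff) (auto simp: aeq_def fdiff_def)
  then have "(\<lambda>m. nsq (h m)) \<longlonglongrightarrow> 0" using k(2) by simp
  then have "\<forall>\<^sub>F m in sequentially. nsq (h m) < e" using \<open>e > 0\<close> by (rule order_tendstoD)
  then obtain m where "nsq (h m) < e" by (auto simp: eventually_sequentially)
  then show ?thesis using LT[of m] unfolding h_def by (intro exI[of _ "L m"]) simp
qed

section \<open>Thinning a fine partition\<close>

text \<open>
  The expected value of \<open>\<phi> y\<close>, where \<open>y\<close> is the meet of \<open>x\<close> with a random selection of the
  entries of \<open>L\<close>, each taken independently with probability \<open>q\<close>; taking \<open>b\<close> deletes the cell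
  \<open>cl b\<close>.
\<close>
fun avg :: "real \<Rightarrow> 'a set set list \<Rightarrow> ('a set set \<Rightarrow> real) \<Rightarrow> 'a set set \<Rightarrow> real" where
  "avg q [] \<phi> x = \<phi> x"
| "avg q (b # L) \<phi> x = (1 - q) * avg q L \<phi> x + q * avg q L \<phi> (x \<inter> b)"

lemma avg_attained:
  assumes "set L \<subseteq> B" "x \<in> B" "0 \<le> q" "q \<le> 1"
  shows "\<exists>y\<in>B. \<phi> y \<le> avg q L \<phi> x"
  using assms(1,2)
proof (induction L arbitrary: x)
  case (Cons b L)
  have b: "b \<in> B" "set L \<subseteq> B" using Cons.prems by auto
  obtain y1 where y1: "y1 \<in> B" "\<phi> y1 \<le> avg q L \<phi> x"
    using Cons.IH[OF b(2) Cons.prems(2)] by blast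
  obtain y2 where y2: "y2 \<in> B" "\<phi> y2 \<le> avg q L \<phi> (x \<inter> b)"
    using Cons.IH[OF b(2) Int_B[OF Cons.prems(2) b(1)]] by blast
  have "min (\<phi> y1) (\<phi> y2) = (1 - q) * min (\<phi> y1) (\<phi> y2) + q * min (\<phi> y1) (\<phi> y2)"
    by (simp add: algebra_simps)
  also have "\<dots> \<le> avg q (b # L) \<phi> x"
    unfolding avg.simps using assms(3,4) y1 y2 by (intro add_mono mult_left_mono) auto
  finally show ?case using y1(1) y2(1) by (auto simp: min_def split: if_splits)
qed auto

lemma avg_const: "avg q L (\<lambda>y. k) x = k"
  by (induction L arbitrary: x) (simp_all add: algebra_simps)

lemma avg_add: "avg q L (\<lambda>y. \<phi> y + \<psi> y) x = avg q L \<phi> x + avg q L \<psi> x"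
  by (induction L arbitrary: x) (simp_all add: algebra_simps)

lemma avg_diff: "avg q L (\<lambda>y. \<phi> y - \<psi> y) x = avg q L \<phi> x - avg q L \<psi> x"
  using avg_add[of q L "\<lambda>y. \<phi> y - \<psi> y" \<psi> x] by simp

lemma avg_sum: "avg q L (\<lambda>y. \<Sum>i<(m::nat). \<phi> i y) x = (\<Sum>i<m. avg q L (\<phi> i) x)"
  by (induction m) (simp_all add: avg_const avg_add)

lemma avg_mono:
  assumes "set L \<subseteq> B" "x \<in> B" "0 \<le> q" "q \<le> 1" "\<And>y. y \<in> B \<Longrightarrow> \<phi> y \<le> \<psi> y"
  shows "avg q L \<phi> x \<le> avg q L \<psi> x"
  using assms(1,2)
proof (induction L arbitrary: x)
  case (Cons b L)
  then show ?case unfolding avg.simps using assms(3,4) Int_B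
    by (intro add_mono mult_left_mono Cons.IH) auto
qed (simp add: assms(5))

lemma avg_cong:
  assumes "set L \<subseteq> B" "x \<in> B" "\<And>y. y \<in> B \<Longrightarrow> \<phi> y = \<psi> y"
  shows "avg q L \<phi> x = avg q L \<psi> x"
  using assms(1,2)
proof (induction L arbitrary: x)
  case (Cons b L)
  then show ?case using Int_B by simp
qed (simp add: assms(3))

lemma avg_shift: "avg q L \<phi> (x \<inter> b) = avg q L (\<lambda>y. \<phi> (y \<inter> b)) x"
proof (induction L arbitrary: x)
  case (Cons a L)
  have "x \<inter> b \<inter> a = x \<inter> a \<inter> b" by blast
  then show ?case using Cons[of x] Cons[of "x \<inter> a"] by simp
qed simp

abbreviation phi :: "('a \<Rightarrow> real) \<Rightarrow> 'a set set \<Rightarrow> real" where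
  "phi v x \<equiv> nsq (P x v)"

lemma P_L2B: "x \<in> B \<Longrightarrow> v \<in> L2 \<Longrightarrow> P x v \<in> L2"
  by (rule P_L2[OF B_csub])

lemma N_L2: "b \<in> B \<Longrightarrow> v \<in> L2 \<Longrightarrow> N b v \<in> L2"
  by (rule cop_L2[OF proj_PB])

lemma phi_Int: assumes "x \<in> B" "b \<in> B" "v \<in> L2" shows "phi v (x \<inter> b) = phi (P b v) x"
  using P_P[OF assms(2,1,3)] P_L2B[OF Int_B[OF assms(1,2)] assms(3)] P_L2B[OF assms(1) P_L2B[OF assms(2,3)]]
  by (intro nsq_cong) (auto simp: Int_commute intro: aeq_sym)

lemma phi_split:
  assumes "x \<in> B" "Alg T" "v \<in> L2" shows "phi v x = phi (T v) x + phi (cop T v) x"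
  by (rule nsq_commute_split[OF proj_PB[OF assms(1)] Alg_proj[OF assms(2)]
        commute_sym[OF Alg_commute_P[OF assms(2,1)]] assms(3)])

lemma phi_le: "x \<in> B \<Longrightarrow> v \<in> L2 \<Longrightarrow> phi v x \<le> nsq v"
  by (rule nsq_proj_le[OF proj_PB])

lemma phi_top: assumes "v \<in> L2" shows "phi v (sets M) = nsq v"
proof (rule nsq_cong)
  have "v \<in> borel_measurable (F (sets M))"
    using L2_meas[OF assms] measurable_cong_sets[OF sets_F[OF top_csub] refl] by blast
  then show "P (sets M) v \<doteq> v" by (rule P_fix[OF top_csub assms])
qed (use assms P_L2B[OF top_B] in auto)

lemma avg_phi_split:
  assumes "set L \<subseteq> B" "x \<in> B" "Alg T" "v \<in> L2"
  shows "avg q L (phi v) x = avg q L (phi (T v)) x + avg q L (phi (cop T v)) x"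
  unfolding avg_add[symmetric] using assms by (intro avg_cong phi_split)

lemma avg_phi_Int:
  assumes "set L \<subseteq> B" "x \<in> B" "b \<in> B" "v \<in> L2"
  shows "avg q L (phi v) (x \<inter> b) = avg q L (phi (P b v)) x"
  unfolding avg_shift using assms by (intro avg_cong phi_Int)

text \<open>
  Conditioning on the fate of the first cell: the part of \<open>v\<close> that does not meet it is unaffected,
  the part that meets it survives with probability \<open>1 - q\<close>.
\<close>
lemma avg_phi_Cons:
  assumes "set L \<subseteq> B" "x \<in> B" "b \<in> B" "v \<in> L2"
  shows "avg q (b # L) (phi v) x = avg q L (phi (P b v)) x + (1 - q) * avg q L (phi (N b v)) x"
  using avg_phi_split[OF assms(1,2) Alg_P[OF assms(3)] assms(4), of q] avg_phi_Int[OF assms, of q]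
  by (simp add: algebra_simps)

text \<open>
  A union bound over the deleted cells.
\<close>
lemma avg_phi_lower:
  assumes "set L \<subseteq> B" "x \<in> B" "0 \<le> q" "q \<le> 1" "v \<in> L2"
  shows "phi v x - q * (\<Sum>b\<leftarrow>L. nsq (N b v)) \<le> avg q L (phi v) x"
  using assms(1,2)
proof (induction L arbitrary: x)
  case (Cons b L)
  let ?S = "\<Sum>b\<leftarrow>L. nsq (N b v)"
  have b: "b \<in> B" "set L \<subseteq> B" using Cons.prems by auto
  have x: "x \<in> B" by fact
  have "phi v x = phi (P b v) x + phi (N b v) x" by (rule phi_split[OF x Alg_P[OF b(1)] assms(5)])
  then have "phi v x - phi v (x \<inter> b) \<le> nsq (N b v)"
    using phi_le[OF x N_L2[OF b(1) assms(5)]] phi_Int[OF x b(1) assms(5)] by simp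
  then have "q * (phi v x - phi v (x \<inter> b)) \<le> q * nsq (N b v)" using assms(3) by (rule mult_left_mono)
  then have "phi v x - q * (nsq (N b v) + ?S)
      \<le> (1 - q) * (phi v x - q * ?S) + q * (phi v (x \<inter> b) - q * ?S)"
    by (simp add: algebra_simps)
  also have "\<dots> \<le> avg q (b # L) (phi v) x"
    unfolding avg.simps using assms(3,4) Cons.IH[OF b(2) x] Cons.IH[OF b(2) Int_B[OF x b(1)]]
    by (intro add_mono mult_left_mono) auto
  finally show ?case by simp
qed simp

lemma H1_N: assumes f: "f \<in> H1" and b: "b \<in> B" shows "N b f \<doteq> P (cl b) f"
proof -
  have "f \<doteq> (\<lambda>w. P b f w + P (cl b) f w)" using f b by (simp add: H1_def)
  then show ?thesis unfolding aeq_def cop_def fdiff_def by eventually_elim simp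
qed

text \<open>
  Bessel's inequality: the components \<open>N b f = P (cl b) f\<close> over disjoint cells are orthogonal.
\<close>
lemma H1_sum_le: "disj L \<Longrightarrow> f \<in> H1 \<Longrightarrow> (\<Sum>b\<leftarrow>L. nsq (N b f)) \<le> nsq f"
proof (induction L arbitrary: f)
  case Nil show ?case by (simp add: nsq_nonneg)
next
  case (Cons b L)
  have b: "b \<in> B" "disj L" "set L \<subseteq> B" "\<forall>d\<in>set L. b \<curlyvee> d = sets M"
    using Cons.prems by (auto simp: disj_def)
  note f = Cons.prems(2)
  have fL: "f \<in> L2" by (rule H1_L2[OF f])
  have Pf: "P b f \<in> H1" by (rule H1_P[OF f b(1)])
  have "nsq (N d f) = nsq (N d (P b f))" if d: "d \<in> set L" for d
  proof (rule nsq_cong)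
    have dB: "d \<in> B" using d b(3) by blast
    have cd: "cl d \<in> B" by (rule cl_B[OF dB])
    have "cl d \<subseteq> b" using d b dB by (intro cl_le) auto
    then have "P (cl d) (P b f) \<doteq> P (cl d) f"
      by (intro P_mono2 B_csub cd b(1) fL)
    then show "N d f \<doteq> N d (P b f)"
      using H1_N[OF f dB] H1_N[OF Pf dB] by (blast intro: aeq_trans aeq_sym)
    show "N d f \<in> L2" "N d (P b f) \<in> L2" by (intro N_L2 dB fL H1_L2[OF Pf])+
  qed
  then have "(\<Sum>d\<leftarrow>L. nsq (N d f)) = (\<Sum>d\<leftarrow>L. nsq (N d (P b f)))"
    by (intro arg_cong[of _ _ sum_list] map_cong) auto
  also have "\<dots> \<le> nsq (P b f)" by (rule Cons.IH[OF b(2) Pf])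
  finally show ?case using nsq_proj_cop[OF proj_PB[OF b(1)] fL] by simp
qed

text \<open>
  The partition resolves \<open>c\<close> when \<open>meet_above c L \<subseteq> c\<close>: then the cell \<open>cl c\<close> is the union of the
  cells of \<open>L\<close> inside it.
\<close>
fun meet_above :: "'a set set \<Rightarrow> 'a set set list \<Rightarrow> 'a set set" where
  "meet_above c [] = sets M"
| "meet_above c (b # L) = (if c \<subseteq> b then b \<inter> meet_above c L else meet_above c L)"

lemma meet_above_B: "set L \<subseteq> B \<Longrightarrow> meet_above c L \<in> B"
  by (induction L) (auto simp: top_B Int_B)

lemma meet_above_top: "meet_above c L \<subseteq> sets M"
  by (induction L) auto

lemma meet_above_le: "b \<in> set L \<Longrightarrow> c \<subseteq> b \<Longrightarrow> meet_above c L \<subseteq> b"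
  by (induction L) auto

lemma meet_above_greatest: "y \<subseteq> sets M \<Longrightarrow> (\<And>b. b \<in> set L \<Longrightarrow> c \<subseteq> b \<Longrightarrow> y \<subseteq> b) \<Longrightarrow> y \<subseteq> meet_above c L"
  by (induction L) auto

lemma disj_remove: "disj (as @ c # bs) \<Longrightarrow> disj (as @ bs)"
  by (auto simp: disj_def sorted_wrt_append)

lemma disj_join: "disj (as @ c # bs) \<Longrightarrow> d \<in> set (as @ bs) \<Longrightarrow> c \<curlyvee> d = sets M"
  by (auto simp: disj_def sorted_wrt_append sjoin_commute[of M c d])

text \<open>
  By hypothesis, \<open>v\<close> is carried by sets that, for each \<open>c\<close> in \<open>cs\<close>, meet a cell of \<open>L\<close> inside
  \<open>cl c\<close>. The cells for different \<open>c\<close> are different, so such a set meets at least \<open>length cs\<close>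
  cells, all of which must survive. In the induction, the sets that meet the first cell may use it
  up for at most one \<open>c\<close>, which is then dropped from \<open>cs\<close>.
\<close>
lemma avg_phi_small:
  assumes q: "0 \<le> q" "q \<le> 1"
  shows "set L \<subseteq> B \<Longrightarrow> disj cs \<Longrightarrow> v \<in> L2 \<Longrightarrow> x \<in> B \<Longrightarrow>
    (\<And>c. c \<in> set cs \<Longrightarrow> P (meet_above c L) v \<doteq> (\<lambda>w. 0)) \<Longrightarrow>
    avg q L (phi v) x \<le> (1 - q) ^ length cs * nsq v"
proof (induction L arbitrary: v cs x)
  case Nil
  show ?case
  proof (cases cs)
    case Nil
    then show ?thesis using phi_le[OF \<open>x \<in> B\<close> \<open>v \<in> L2\<close>] by simp
  next
    case (Cons c cs')
    then have "P (sets M) v \<doteq> (\<lambda>w. 0)" using Nil.prems(5)[of c] by simp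
    then have "nsq v = 0"
      using phi_top[OF Nil.prems(3)] nsq_eq_0[OF P_L2B[OF top_B Nil.prems(3)]] by simp
    then show ?thesis using phi_le[OF \<open>x \<in> B\<close> \<open>v \<in> L2\<close>] by simp
  qed
next
  case (Cons b L)
  let ?p = "1 - q"
  have b: "b \<in> B" and LB: "set L \<subseteq> B" using Cons.prems(1) by auto
  note v = Cons.prems(3) and x = Cons.prems(4) and dj = Cons.prems(2) and kill = Cons.prems(5)
  have vL: "P b v \<in> L2" "N b v \<in> L2" by (rule P_L2B[OF b v], rule N_L2[OF b v])
  have sum: "nsq v = nsq (P b v) + nsq (N b v)" by (rule nsq_proj_cop[OF proj_PB[OF b] v])
  have p: "0 \<le> ?p" "?p \<le> 1" using q by auto
  have killP: "P (meet_above c L) (P b v) \<doteq> (\<lambda>w. 0)" if c: "c \<in> set cs" for c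
  proof -
    have m: "meet_above c L \<in> B" by (rule meet_above_B[OF LB])
    show ?thesis
    proof (cases "c \<subseteq> b")
      case True
      then show ?thesis using kill[OF c] P_P[OF b m v] by (auto intro: aeq_trans)
    next
      case False
      then have "P (meet_above c L) v \<doteq> (\<lambda>w. 0)" using kill[OF c] by simp
      then show ?thesis
        by (rule commute_0[OF proj_PB[OF b] commute_P[OF b m] v proj_PB[OF m]])
    qed
  qed
  have killN: "P (meet_above c L) (N b v) \<doteq> (\<lambda>w. 0)" if "c \<in> set cs" "\<not> c \<subseteq> b" for c
  proof -
    have m: "meet_above c L \<in> B" by (rule meet_above_B[OF LB])
    have "P (meet_above c L) v \<doteq> (\<lambda>w. 0)" using kill[OF that(1)] that(2) by simp
    then show ?thesis
      by (rule commute_0[OF Alg_proj[OF Alg_N[OF b]] Alg_commute_P[OF Alg_N[OF b] m] v proj_PB[OF m]])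
  qed
  have 1: "avg q L (phi (P b v)) x \<le> ?p ^ length cs * nsq (P b v)"
    by (rule Cons.IH[OF LB dj vL(1) x killP])
  have key: "avg q (b # L) (phi v) x \<le> ?p ^ length cs * nsq v"
    if 2: "?p * avg q L (phi (N b v)) x \<le> ?p ^ length cs * nsq (N b v)"
    using 1 2 avg_phi_Cons[OF LB x b v, of q] unfolding sum distrib_left by linarith
  show ?case
  proof (cases "\<exists>c\<in>set cs. c \<subseteq> b")
    case False
    then have "avg q L (phi (N b v)) x \<le> ?p ^ length cs * nsq (N b v)"
      by (intro Cons.IH[OF LB dj vL(2) x] killN) auto
    then have "?p * avg q L (phi (N b v)) x \<le> ?p * (?p ^ length cs * nsq (N b v))"
      using p(1) by (rule mult_left_mono)
    also have "\<dots> \<le> 1 * (?p ^ length cs * nsq (N b v))"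
      using p by (intro mult_right_mono mult_nonneg_nonneg zero_le_power nsq_nonneg) auto
    finally show ?thesis by (intro key) simp
  next
    case True
    then obtain c where c: "c \<in> set cs" "c \<subseteq> b" by blast
    obtain as bs where sp: "cs = as @ c # bs" using split_list[OF c(1)] by blast
    have dj': "disj (as @ bs)" using disj_remove dj sp by blast
    show ?thesis
    proof (cases "b = sets M")
      case b1: True
      have xb: "x \<inter> b = x" using csubD(2)[OF B_csub[OF x]] b1 by blast
      have "avg q (b # L) (phi v) x = avg q L (phi v) x"
        by (simp add: xb algebra_simps)
      also have "\<dots> \<le> ?p ^ length cs * nsq v"
      proof (rule Cons.IH[OF LB dj v x])
        fix d assume d: "d \<in> set cs"
        have "d \<subseteq> b" using d dj csubD(2)[OF B_csub, of d] b1 by (auto simp: disj_def)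
        then have "meet_above d (b # L) = meet_above d L" using meet_above_top[of d L] b1 by auto
        then show "P (meet_above d L) v \<doteq> (\<lambda>w. 0)" using kill[OF d] by simp
      qed
      finally show ?thesis .
    next
      case False
      have nle: "\<not> d \<subseteq> b" if d: "d \<in> set (as @ bs)" for d
      proof
        assume "d \<subseteq> b"
        then have "c \<curlyvee> d \<subseteq> b" using c(2) by (intro join_least B_csub b)
        then show False
          using disj_join[OF dj[unfolded sp] d] csubD(2)[OF B_csub[OF b]] False by blast
      qed
      have "avg q L (phi (N b v)) x \<le> ?p ^ length (as @ bs) * nsq (N b v)"
        using nle by (intro Cons.IH[OF LB dj' vL(2) x] killN) (auto simp: sp)
      then have "?p * avg q L (phi (N b v)) x \<le> ?p * (?p ^ length (as @ bs) * nsq (N b v))"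
        using p(1) by (rule mult_left_mono)
      also have "\<dots> = ?p ^ length cs * nsq (N b v)" by (simp add: sp)
      finally show ?thesis by (rule key)
    qed
  qed
qed

text \<open>
  What \<open>Z As\<close> removes is an orthogonal sum of pieces of the form \<open>Ns cs u\<close>, to each of which
  \<open>avg_phi_small\<close> applies, and these pieces stay orthogonal under every \<open>P y\<close>.
\<close>
lemma avg_phi_Z:
  assumes q: "0 \<le> q" "q \<le> 1" and L: "set L \<subseteq> B" and x: "x \<in> B" and g: "g \<in> L2"
    and As: "set As \<subseteq> tuples n" "\<And>cs c. cs \<in> set As \<Longrightarrow> c \<in> set cs \<Longrightarrow> meet_above c L \<subseteq> c"
  shows "avg q L (phi g) x \<le> (1 - q) ^ n * nsq g + nsq (Z As g)"
proof -
  have "avg q L (phi g) x \<le> (1 - q) ^ n * (nsq g - nsq (Z As g)) + avg q L (phi (Z As g)) x"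
    using As
  proof (induction As)
    case Nil then show ?case by (simp add: Z_simps)
  next
    case (Cons cs As)
    let ?u = "Z As g"
    have cs: "cs \<in> tuples n" and AsT: "set As \<subseteq> tuples n" using Cons.prems(1) by auto
    have u: "?u \<in> L2" by (rule proj_L2[OF Alg_proj[OF Alg_Z[OF AsT]] g])
    note aN = Alg_Ns[OF tuples_B[OF cs]]
    have Nu: "Ns cs ?u \<in> L2" by (rule proj_L2[OF Alg_proj[OF aN] u])
    have "avg q L (phi (Ns cs ?u)) x \<le> (1 - q) ^ length cs * nsq (Ns cs ?u)"
    proof (rule avg_phi_small[OF q L _ Nu x])
      show "disj cs" using cs by (simp add: tuples_def)
      fix c assume c: "c \<in> set cs"
      then have "c \<in> B" using tuples_B[OF cs] by blast
      then show "P (meet_above c L) (Ns cs ?u) \<doteq> (\<lambda>w. 0)"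
        using Cons.prems(2)[of cs c] c
        by (intro P_0_mono[OF B_csub[OF meet_above_B[OF L]] B_csub _ Nu P_Ns_0[OF c tuples_B[OF cs] u]]) auto
    qed
    moreover have "length cs = n" using cs by (simp add: tuples_def)
    moreover have "nsq ?u = nsq (Ns cs ?u) + nsq (Z (cs # As) g)"
      unfolding Z_simps by (rule nsq_proj_cop[OF Alg_proj[OF aN] u])
    moreover have "avg q L (phi ?u) x = avg q L (phi (Ns cs ?u)) x + avg q L (phi (Z (cs # As) g)) x"
      unfolding Z_simps by (rule avg_phi_split[OF L x aN u])
    moreover have "avg q L (phi g) x \<le> (1 - q) ^ n * (nsq g - nsq ?u) + avg q L (phi ?u) x"
      using Cons.prems by (intro Cons.IH) auto
    ultimately show ?case by (simp add: algebra_simps)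
  qed
  also have "avg q L (phi (Z As g)) x \<le> avg q L (\<lambda>y. nsq (Z As g)) x"
    by (intro avg_mono L x q phi_le proj_L2[OF Alg_proj[OF Alg_Z[OF As(1)]] g])
  also have "\<dots> = nsq (Z As g)" by (rule avg_const)
  also have "(1 - q) ^ n * (nsq g - nsq (Z As g)) \<le> (1 - q) ^ n * nsq g"
    using q nsq_nonneg by (intro mult_left_mono) auto
  finally show ?thesis by simp
qed

lemma le_meet_above_join:
  assumes "set L \<subseteq> B" "z \<in> B" "y \<subseteq> sets M" "\<And>b. b \<in> set L \<Longrightarrow> y \<subseteq> b \<curlyvee> z"
  shows "y \<subseteq> meet_above triv L \<curlyvee> z"
  using assms(1,4)
proof (induction L)
  case Nil
  then show ?case using assms(3) sjoin_upper(1)[of "sets M" M z] by auto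
next
  case (Cons b L)
  have b: "b \<in> B" "meet_above triv L \<in> B" using Cons.prems(1) meet_above_B[of L triv] by auto
  have "y \<subseteq> (z \<curlyvee> b) \<inter> (z \<curlyvee> meet_above triv L)"
    using Cons by (auto simp: sjoin_commute[of M z])
  also have "\<dots> = (b \<inter> meet_above triv L) \<curlyvee> z"
    using distrib2[OF assms(2) b] by (simp add: sjoin_commute[of M z])
  also have "b \<inter> meet_above triv L = meet_above triv (b # L)"
    using triv_least[OF B_csub[OF b(1)]] by simp
  finally show ?case .
qed

text \<open>
  Cutting every cell by \<open>z\<close> resolves \<open>z\<close> and keeps what was resolved before. Resolving the trivial
  field expresses that the cells cover everything; it is what makes the cut by \<open>z\<close> effective.
\<close>
lemma refinement:
  "set zs \<subseteq> B \<Longrightarrow> \<exists>L. disj L \<and> meet_above triv L \<subseteq> triv \<and> (\<forall>z\<in>set zs. meet_above z L \<subseteq> z)"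
proof (induction zs)
  case Nil
  show ?case by (rule exI[of _ "[triv]"]) (simp add: disj_def triv_B)
next
  case (Cons z zs)
  then obtain L where L: "disj L" "meet_above triv L \<subseteq> triv" "\<forall>z\<in>set zs. meet_above z L \<subseteq> z" by auto
  have z: "z \<in> B" "cl z \<in> B" using Cons.prems cl_B by auto
  have LB: "set L \<subseteq> B" using L(1) by (simp add: disj_def)
  define L' where "L' = map (\<lambda>b. b \<curlyvee> z) L @ map (\<lambda>b. b \<curlyvee> cl z) L"
  have L'B: "set L' \<subseteq> B" unfolding L'_def using LB z join_B by auto
  have sw: "sorted_wrt (\<lambda>c d. c \<curlyvee> d = sets M) (map (\<lambda>b. b \<curlyvee> y) L)" if y: "y \<in> B" for y
    unfolding sorted_wrt_map
  proof (rule sorted_wrt_mono_rel[of L "\<lambda>c d. c \<curlyvee> d = sets M"])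
    show "sorted_wrt (\<lambda>c d. c \<curlyvee> d = sets M) L" using L(1) by (simp add: disj_def)
    fix b d assume "b \<in> set L" "d \<in> set L" and bd: "b \<curlyvee> d = sets M"
    then have "b \<in> B" "d \<in> B" using LB by auto
    then show "(b \<curlyvee> y) \<curlyvee> (d \<curlyvee> y) = sets M"
      by (intro join_top_mono[OF bd sjoin_upper(1) sjoin_upper(1)] B_csub join_B y)
  qed
  have cross: "(b \<curlyvee> z) \<curlyvee> (d \<curlyvee> cl z) = sets M" if "b \<in> set L" "d \<in> set L" for b d
  proof -
    have "b \<in> B" "d \<in> B" using that LB by auto
    then show ?thesis
      by (intro join_top_mono[OF cl_join[OF z(1)] sjoin_upper(2) sjoin_upper(2)] B_csub join_B z)
  qed
  have dj: "disj L'"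
    using L'B sw[OF z(1)] sw[OF z(2)] cross unfolding disj_def L'_def by (auto simp: sorted_wrt_append)
  have old: "meet_above d L' \<subseteq> d" if d: "meet_above d L \<subseteq> d" for d
  proof -
    have "meet_above d L' \<subseteq> meet_above d L"
    proof (rule meet_above_greatest[OF meet_above_top])
      fix b assume b: "b \<in> set L" "d \<subseteq> b"
      have bB: "b \<in> B" using b LB by blast
      have "meet_above d L' \<subseteq> b \<curlyvee> z"
        using b sjoin_upper(1)[of b M z] by (intro meet_above_le) (auto simp: L'_def)
      moreover have "meet_above d L' \<subseteq> b \<curlyvee> cl z"
        using b sjoin_upper(1)[of b M "cl z"] by (intro meet_above_le) (auto simp: L'_def)
      ultimately show "meet_above d L' \<subseteq> b" using split_cl[OF bB z(1)] by blast
    qed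
    then show ?thesis using d by blast
  qed
  have new: "meet_above z L' \<subseteq> z"
  proof -
    have "meet_above z L' \<subseteq> meet_above triv L \<curlyvee> z"
    proof (rule le_meet_above_join[OF LB z(1) meet_above_top])
      fix b assume "b \<in> set L"
      then show "meet_above z L' \<subseteq> b \<curlyvee> z"
        using sjoin_upper(2)[of z M b] by (intro meet_above_le) (auto simp: L'_def)
    qed
    also have "\<dots> \<subseteq> z"
      using L(2) triv_least[OF B_csub[OF z(1)]] by (intro join_least B_csub z) auto
    finally show ?thesis .
  qed
  show ?case using dj old L(2,3) new by (intro exI[of _ L']) auto
qed

text \<open>
  First \<open>q\<close> is chosen so that the losses of the \<open>f i\<close> stay below \<open>e / 2\<close>, then \<open>n\<close> so that
  \<open>(1 - q) ^ n\<close> controls the part of the \<open>g i\<close> that meets \<open>n\<close> cells, and finally the partition, so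
  that it resolves lists of cells for which the rest of the \<open>g i\<close> is small. The sum of all errors
  is then on average at most \<open>e\<close>.
\<close>
lemma thinning_exists:
  fixes f g :: "nat \<Rightarrow> 'a \<Rightarrow> real"
  assumes f: "\<And>i. f i \<in> H1" and g: "\<And>i. g i \<in> L2" "\<And>i. P stb (g i) \<doteq> (\<lambda>w. 0)" and e: "e > 0"
  shows "\<exists>x\<in>B. \<forall>i<m. nsq (N x (f i)) \<le> e \<and> nsq (P x (g i)) \<le> e"
proof -
  define Sf Sg where "Sf = (\<Sum>i<m. nsq (f i))" and "Sg = (\<Sum>i<m. nsq (g i))"
  have S: "0 \<le> Sf" "0 \<le> Sg" unfolding Sf_def Sg_def by (auto intro: sum_nonneg nsq_nonneg)
  define q where "q = min (1/2) (e / (2 * (1 + Sf)))"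
  have q: "0 < q" "q < 1" "0 \<le> q" "q \<le> 1" using S e by (auto simp: q_def min_def)
  have "q * Sf \<le> e / (2 * (1 + Sf)) * Sf" using S by (intro mult_right_mono) (auto simp: q_def)
  also have "\<dots> \<le> e / 2" using S e by (simp add: field_simps)
  finally have qS: "q * Sf \<le> e / 2" .
  have "(\<lambda>n. (1 - q)^n * Sg) \<longlonglongrightarrow> 0"
    using q by (intro tendsto_mult_left_zero LIMSEQ_power_zero) simp
  then have "\<forall>\<^sub>F n in sequentially. (1 - q)^n * Sg < e / 4" using e by (intro order_tendstoD) auto
  then obtain n where n: "(1 - q)^n * Sg < e / 4" by (auto simp: eventually_sequentially)
  define d where "d = e / (4 * (1 + real m))"
  have d: "d > 0" "real m * d \<le> e / 4" using e by (auto simp: d_def field_simps)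
  have "\<forall>i. \<exists>As. set As \<subseteq> tuples n \<and> nsq (Z As (g i)) \<le> d"
    using Z_small[OF g d(1)] by blast
  then obtain A where A: "\<And>i. set (A i) \<subseteq> tuples n" "\<And>i. nsq (Z (A i) (g i)) \<le> d" by metis
  define zs where "zs = concat (concat (map A [0..<m]))"
  have "set zs \<subseteq> B" unfolding zs_def using A(1) tuples_B by fastforce
  then obtain L where L: "disj L" "\<forall>z\<in>set zs. meet_above z L \<subseteq> z" using refinement by blast
  have LB: "set L \<subseteq> B" using L(1) by (simp add: disj_def)
  define \<phi> where "\<phi> x = (\<Sum>i<m. (nsq (f i) - phi (f i) x) + phi (g i) x)" for x
  have "avg q L \<phi> (sets M) = (\<Sum>i<m. (nsq (f i) - avg q L (phi (f i)) (sets M)) + avg q L (phi (g i)) (sets M))"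
    unfolding \<phi>_def by (simp only: avg_sum avg_add avg_diff avg_const)
  also have "\<dots> \<le> (\<Sum>i<m. q * nsq (f i) + ((1 - q)^n * nsq (g i) + d))"
  proof (intro sum_mono add_mono)
    fix i assume i: "i \<in> {..<m}"
    have "nsq (f i) - q * nsq (f i) \<le> phi (f i) (sets M) - q * (\<Sum>b\<leftarrow>L. nsq (N b (f i)))"
      using phi_top[OF H1_L2[OF f]] mult_left_mono[OF H1_sum_le[OF L(1) f] q(3)] by simp
    also have "\<dots> \<le> avg q L (phi (f i)) (sets M)"
      by (rule avg_phi_lower[OF LB top_B q(3,4) H1_L2[OF f]])
    finally show "nsq (f i) - avg q L (phi (f i)) (sets M) \<le> q * nsq (f i)" by simp
    have "avg q L (phi (g i)) (sets M) \<le> (1 - q)^n * nsq (g i) + nsq (Z (A i) (g i))"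
    proof (rule avg_phi_Z[OF q(3,4) LB top_B g(1) A(1)])
      fix cs c assume "cs \<in> set (A i)" "c \<in> set cs"
      then have "c \<in> set zs" using i by (auto simp: zs_def)
      then show "meet_above c L \<subseteq> c" using L(2) by blast
    qed
    then show "avg q L (phi (g i)) (sets M) \<le> (1 - q)^n * nsq (g i) + d" using A(2)[of i] by linarith
  qed
  also have "\<dots> = q * Sf + ((1 - q)^n * Sg + real m * d)"
    by (simp add: Sf_def Sg_def sum.distrib sum_distrib_left)
  also have "\<dots> \<le> e" using qS n d(2) e by linarith
  finally have le: "avg q L \<phi> (sets M) \<le> e" .
  obtain x where x: "x \<in> B" "\<phi> x \<le> e"
    using avg_attained[OF LB top_B q(3,4), of \<phi>] le by force
  have N: "nsq (f i) - phi (f i) x = nsq (N x (f i))" for i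
    using nsq_proj_cop[OF proj_PB[OF x(1)] H1_L2[OF f]] by simp
  have "nsq (N x (f i)) + phi (g i) x \<le> e" if "i < m" for i
  proof -
    have "nsq (N x (f i)) + phi (g i) x \<le> \<phi> x"
      unfolding \<phi>_def N using that
      by (intro member_le_sum[of i "{..<m}" "\<lambda>i. nsq (N x (f i)) + phi (g i) x"])
         (auto intro: add_nonneg_nonneg nsq_nonneg)
    then show ?thesis using x(2) by linarith
  qed
  then have "nsq (N x (f i)) \<le> e \<and> phi (g i) x \<le> e" if "i < m" for i
    using that nsq_nonneg[of "N x (f i)"] nsq_nonneg[of "P x (g i)"] by force
  then show ?thesis using x(1) by blast
qed

end

section \<open>The stable field as a lower limit\<close>

lemma csub_INT:
  assumes "\<And>i. X i \<in> complete_subfields M"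
  shows "(\<Inter>i. X i) \<in> complete_subfields M"
proof -
  have "sigma_algebra (space M) (\<Inter>i. X i)"
    unfolding sigma_algebra_iff2
  proof (intro conjI ballI allI impI)
    note s = csubD(1)[OF assms, unfolded sigma_algebra_iff2]
    show "(\<Inter>i. X i) \<subseteq> Pow (space M)" using s by blast
    show "{} \<in> (\<Inter>i. X i)" using s by blast
    show "space M - A \<in> (\<Inter>i. X i)" if "A \<in> (\<Inter>i. X i)" for A using s that by blast
    show "(\<Union>n::nat. A n) \<in> (\<Inter>i. X i)" if A: "range A \<subseteq> (\<Inter>i. X i)" for A
    proof
      fix i
      have "range A \<subseteq> X i" using A by blast
      then show "(\<Union>n::nat. A n) \<in> X i" using s[of i] by blast
    qed
  qed
  then show ?thesis using csubD(2,3)[OF assms] unfolding complete_subfields_def by blast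
qed

lemma (in prob_space) measF_INT:
  fixes u :: "'a \<Rightarrow> real"
  assumes X: "\<And>i. X i \<in> complete_subfields M" and u: "\<And>i. u \<in> borel_measurable (F (X i))"
  shows "u \<in> borel_measurable (F (\<Inter>i. X i))"
proof (rule measurableI)
  fix A :: "real set" assume A: "A \<in> sets borel"
  have "u -` A \<inter> space M \<in> X i" for i
    using measurable_sets[OF u A, of i] by (simp add: sets_F[OF X] space_F[OF X])
  then show "u -` A \<inter> space (F (\<Inter>i. X i)) \<in> sets (F (\<Inter>i. X i))"
    using csub_INT[of X, OF X] by (simp add: sets_F space_F)
qed simp

text \<open>
  Taking real parts does not increase the distance to a real function.
\<close>
lemma (in prob_space) separable_real:
  assumes "essentially_separable M"
  shows "\<exists>d::nat \<Rightarrow> 'a \<Rightarrow> real. (\<forall>i. d i \<in> L2) \<and> (\<forall>u\<in>L2. \<forall>e>0. \<exists>i. nsq (u \<ominus> d i) < e)"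
proof -
  obtain D where D: "countable D" "D \<subseteq> L2_fun M"
    and dense: "\<And>f e. f \<in> L2_fun M \<Longrightarrow> e > 0 \<Longrightarrow> \<exists>g\<in>D. L2_dist M f g < e"
    using assms unfolding essentially_separable_def by blast
  have "(\<lambda>w. 0) \<in> L2_fun M" by (simp add: L2_fun_def)
  from dense[OF this, of 1] have ne: "D \<noteq> {}" by auto
  define d where "d i = (\<lambda>w. Re (from_nat_into D i w))" for i
  show ?thesis
  proof (intro exI[of _ d] conjI allI ballI impI)
    show "d i \<in> L2" for i
      unfolding d_def using L2_fun_parts(1) D(2) from_nat_into[OF ne, of i] by blast
    fix u :: "'a \<Rightarrow> real" and e :: real assume u: "u \<in> L2" and e: "e > 0"
    have uL: "(\<lambda>w. complex_of_real (u w)) \<in> L2_fun M"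
      using L2_meas[OF u] L2_sq[OF u] by (auto simp: L2_fun_def)
    obtain g where g: "g \<in> D" "L2_dist M (\<lambda>w. complex_of_real (u w)) g < sqrt e"
      using dense[OF uL, of "sqrt e"] e by auto
    have gL: "g \<in> L2_fun M" using g(1) D(2) by blast
    obtain i where i: "g = from_nat_into D i" using g(1) D(1) by (metis from_nat_into_to_nat_on)
    note Im = L2_fun_parts(2)[OF gL]
    have Re: "u \<ominus> (\<lambda>w. Re (g w)) \<in> L2" by (intro L2_fdiff u L2_fun_parts(1) gL)
    have eq: "(cmod (complex_of_real (u w) - g w))\<^sup>2 = ((u \<ominus> (\<lambda>w. Re (g w))) w)\<^sup>2 + (Im (g w))\<^sup>2" for w
      by (simp add: cmod_power2 fdiff_def)
    have "nsq (u \<ominus> d i) = (\<integral>w. ((u \<ominus> (\<lambda>w. Re (g w))) w)\<^sup>2 \<partial>M)"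
      by (simp add: nsq_integral d_def i)
    also have "\<dots> \<le> (\<integral>w. (cmod (complex_of_real (u w) - g w))\<^sup>2 \<partial>M)"
      unfolding eq by (intro integral_mono Bochner_Integration.integrable_add L2_sq Re Im) simp
    also have "\<dots> < e"
      using g(2) unfolding L2_dist_def by simp
    finally show "\<exists>i. nsq (u \<ominus> d i) < e" by blast
  qed
qed

context noise
begin

lemma H1_0: "(\<lambda>w. 0) \<in> H1"
  unfolding H1_def
proof (intro CollectI conjI ballI L2_const)
  fix x assume x: "x \<in> B"
  show "(\<lambda>w. 0) \<doteq> (\<lambda>w. P x (\<lambda>w. 0) w + P (cl x) (\<lambda>w. 0) w)"
    using proj_0[OF proj_PB[OF x]] proj_0[OF proj_PB[OF cl_B[OF x]]]
    unfolding aeq_def by eventually_elim simp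
qed

text \<open>
  Separability passes to subsets: near each \<open>d i\<close> a point of the first chaos is chosen, at every
  scale at which there is one.
\<close>
lemma H1_separable:
  assumes d: "\<And>i::nat. d i \<in> L2" "\<And>u e. u \<in> L2 \<Longrightarrow> e > 0 \<Longrightarrow> \<exists>i. nsq (u \<ominus> d i) < e"
  shows "\<exists>f::nat \<Rightarrow> 'a \<Rightarrow> real. (\<forall>i. f i \<in> H1) \<and> (\<forall>u\<in>H1. \<forall>e>0. \<exists>i. nsq (u \<ominus> f i) < e)"
proof -
  have "\<forall>i k. \<exists>f\<in>H1. (\<exists>f\<in>H1. nsq (f \<ominus> d i) < 1 / Suc k) \<longrightarrow> nsq (f \<ominus> d i) < 1 / Suc k"
    using H1_0 by blast
  then obtain f where f: "\<And>i k. f i k \<in> H1"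
    "\<And>i k. \<exists>f\<in>H1. nsq (f \<ominus> d i) < 1 / Suc k \<Longrightarrow> nsq (f i k \<ominus> d i) < 1 / Suc k" by metis
  show ?thesis
  proof (intro exI[of _ "\<lambda>n. case prod_decode n of (i, k) \<Rightarrow> f i k"] conjI allI ballI impI)
    show "(case prod_decode n of (i, k) \<Rightarrow> f i k) \<in> H1" for n by (simp add: f(1) split: prod.split)
    fix u and e :: real assume u: "u \<in> H1" and e: "e > 0"
    note uL = H1_L2[OF u]
    obtain k where k: "1 / Suc k < e / 4" using nat_approx_posE[of "e/4"] e by auto
    obtain i where i: "nsq (u \<ominus> d i) < 1 / Suc k" using d(2)[OF uL, of "1 / Suc k"] by auto
    then have "nsq (f i k \<ominus> d i) < 1 / Suc k" using u by (intro f(2)) blast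
    moreover have "nsq (u \<ominus> f i k) \<le> 2 * nsq (u \<ominus> d i) + 2 * nsq (d i \<ominus> f i k)"
      by (intro nsq_triangle2 uL d(1) H1_L2 f(1))
    ultimately have "nsq (u \<ominus> f i k) < e" using i k nsq_diff_commute[of "d i" "f i k"] by linarith
    then show "\<exists>n. nsq (u \<ominus> (case prod_decode n of (i, k) \<Rightarrow> f i k)) < e"
      by (intro exI[of _ "prod_encode (i, k)"]) simp
  qed
qed

text \<open>
  The projection \<open>P y u\<close> minimizes the distance of \<open>u\<close> to the functions measurable for \<open>y\<close>.
\<close>
lemma best_approx:
  assumes y: "y \<in> complete_subfields M" and u: "u \<in> L2" and v: "v \<in> L2" "v \<in> borel_measurable (F y)"
  shows "nsq (cop (P y) u) \<le> nsq (u \<ominus> v)"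
proof -
  note T = proj_cop[OF proj_P[OF y]]
  have "cop (P y) v \<doteq> (\<lambda>w. 0)" using P_fix[OF y v] by (simp add: cop_eq_0)
  then have "cop (P y) u \<doteq> cop (P y) u \<ominus> cop (P y) v"
    unfolding aeq_def fdiff_def by eventually_elim simp
  also have "\<dots> \<doteq> cop (P y) (u \<ominus> v)" by (rule aeq_sym[OF proj_fdiff[OF T u v(1)]])
  finally have "nsq (cop (P y) u) = nsq (cop (P y) (u \<ominus> v))"
    by (intro nsq_cong) (use proj_L2[OF T] u L2_fdiff[OF u v(1)] in auto)
  also have "\<dots> \<le> nsq (u \<ominus> v)" by (rule nsq_proj_le[OF T L2_fdiff[OF u v(1)]])
  finally show ?thesis .
qed

fun pmeet :: "(nat \<Rightarrow> 'a set set) \<Rightarrow> nat \<Rightarrow> 'a set set" where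
  "pmeet x 0 = x 0"
| "pmeet x (Suc j) = pmeet x j \<inter> x (Suc j)"

lemma pmeet_B: "(\<And>i. x i \<in> B) \<Longrightarrow> pmeet x j \<in> B"
  by (induction j) (auto intro: Int_B)

lemma pmeet_antimono: "i \<le> j \<Longrightarrow> pmeet x j \<subseteq> pmeet x i"
  by (induction j rule: dec_induct) auto

lemma pmeet_INT: "(\<Inter>j. pmeet x j) = (\<Inter>j. x j)"
proof
  have "pmeet x j \<subseteq> x j" for j by (cases j) auto
  then show "(\<Inter>j. pmeet x j) \<subseteq> (\<Inter>j. x j)" by blast
  have "(\<Inter>j. x j) \<subseteq> pmeet x j" for j by (induction j) auto
  then show "(\<Inter>j. x j) \<subseteq> (\<Inter>j. pmeet x j)" by blast
qed

text \<open>
  The conditional expectations of \<open>f\<close> on the finite meets form a fast Cauchy sequence, because each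
  further factor moves them by at most its own loss; the limit is measurable for every finite meet.
\<close>
lemma meet_approx:
  assumes x: "\<And>i. x i \<in> B" and f: "f \<in> L2" and N: "\<And>i. nsq (N (x i) f) \<le> (1/4) ^ (n + i)"
  shows "\<exists>k\<in>L2. k \<in> borel_measurable (F (\<Inter>i. x i)) \<and> nsq (f \<ominus> k) \<le> 8 * (1/4)^n"
proof -
  define h where "h j = P (pmeet x j) f" for j
  note W = pmeet_B[of x, OF x]
  have h: "h j \<in> L2" for j unfolding h_def by (rule P_L2B[OF W f])
  have NL: "N (x j) f \<in> L2" for j by (rule N_L2[OF x f])
  have step: "nsq (h j \<ominus> h (Suc j)) \<le> (1/4) ^ (n + Suc j)" for j
  proof -
    have "P (pmeet x j) (N (x (Suc j)) f) \<doteq> h j \<ominus> P (pmeet x j) (P (x (Suc j)) f)"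
      unfolding cop_def h_def by (rule proj_fdiff[OF proj_PB[OF W] f P_L2B[OF x f]])
    also have "\<dots> \<doteq> h j \<ominus> h (Suc j)"
      unfolding h_def using P_P[OF x[of "Suc j"] W[of j] f] by (intro fdiff_cong) (auto simp: Int_commute)
    finally have "nsq (h j \<ominus> h (Suc j)) = nsq (P (pmeet x j) (N (x (Suc j)) f))"
      by (intro nsq_cong L2_fdiff h P_L2B W NL) (rule aeq_sym)
    also have "\<dots> \<le> nsq (N (x (Suc j)) f)" by (rule nsq_proj_le[OF proj_PB[OF W] NL])
    finally show ?thesis using N[of "Suc j"] by linarith
  qed
  have "(1/4::real) ^ (n + Suc j) \<le> (1/4) ^ j" for j by (rule power_decreasing) auto
  then have "nsq (h j \<ominus> h (Suc j)) \<le> (1/4) ^ j" for j using step[of j] by (rule order_trans[rotated])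
  then obtain k where k: "k \<in> L2" "(\<lambda>j. nsq (h j \<ominus> k)) \<longlonglongrightarrow> 0"
    using L2_complete[of h] h by blast
  have sq: "sqrt ((1/4) ^ i) = (1/2::real) ^ i" for i by (simp add: real_sqrt_power real_sqrt_divide)
  have dist: "sqrt (nsq (f \<ominus> h j)) \<le> 2 * (1/2)^n - (1/2)^(n + j)" for j
  proof (induction j)
    case 0
    have "sqrt (nsq (f \<ominus> h 0)) \<le> sqrt ((1/4)^n)"
      using N[of 0] by (intro real_sqrt_le_mono) (simp add: h_def cop_def)
    then show ?case by (simp add: sq)
  next
    case (Suc j)
    have "sqrt (nsq (f \<ominus> h (Suc j))) \<le> sqrt (nsq (f \<ominus> h j)) + sqrt (nsq (h j \<ominus> h (Suc j)))"
      by (rule sqrt_nsq_triangle[OF f h h])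
    also have "\<dots> \<le> (2 * (1/2)^n - (1/2)^(n + j)) + sqrt ((1/4) ^ (n + Suc j))"
      by (intro add_mono Suc real_sqrt_le_mono step)
    finally show ?case unfolding sq by simp
  qed
  have bound: "nsq (f \<ominus> h j) \<le> 4 * (1/4)^n" for j
  proof -
    have "(0::real) \<le> (1/2)^(n + j)" by simp
    then have "sqrt (nsq (f \<ominus> h j)) \<le> 2 * (1/2)^n" using dist[of j] by linarith
    then have "(sqrt (nsq (f \<ominus> h j)))\<^sup>2 \<le> (2 * (1/2)^n)\<^sup>2"
      by (intro power_mono) (auto simp: nsq_nonneg)
    moreover have "((1/2)^n)\<^sup>2 = (1/4 :: real)^n"
      unfolding power2_eq_square power_mult_distrib[symmetric] by simp
    ultimately show ?thesis by (simp only: real_sqrt_pow2[OF nsq_nonneg] power_mult_distrib) simp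
  qed
  have "nsq (f \<ominus> k) \<le> 8 * (1/4)^n + 2 * nsq (h j \<ominus> k)" for j
    using nsq_triangle2[OF f h[of j] k(1)] bound[of j] by linarith
  moreover have "(\<lambda>j. 8 * (1/4)^n + 2 * nsq (h j \<ominus> k)) \<longlonglongrightarrow> 8 * (1/4)^n + 2 * 0"
    by (intro tendsto_intros k(2))
  ultimately have "nsq (f \<ominus> k) \<le> 8 * (1/4)^n" by (intro LIMSEQ_le_const) auto
  moreover have "k \<in> borel_measurable (F (pmeet x j))" for j
  proof -
    have "N (pmeet x j) k \<doteq> (\<lambda>w. 0)"
    proof (rule proj_lim_0[OF Alg_proj[OF Alg_N[OF W]] h k])
      have "nsq (N (pmeet x j) (h l)) = 0" if l: "j \<le> l" for l
      proof -
        have "P (pmeet x j) (h l) \<doteq> h l"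
          unfolding h_def by (intro P_mono1 B_csub W f pmeet_antimono l)
        then show ?thesis using nsq_eq_0[OF N_L2[OF W h]] by (simp add: cop_eq_0)
      qed
      then have "\<forall>\<^sub>F l in sequentially. nsq (N (pmeet x j) (h l)) = 0"
        by (rule eventually_sequentiallyI)
      then show "(\<lambda>l. nsq (N (pmeet x j) (h l))) \<longlonglongrightarrow> 0" by (rule tendsto_eventually)
    qed
    then show ?thesis by (intro P_fixD[OF B_csub[OF W] k(1)]) (simp add: cop_eq_0)
  qed
  then have "k \<in> borel_measurable (F (\<Inter>j. pmeet x j))"
    by (rule measF_INT[OF B_csub[OF W]])
  then have "k \<in> borel_measurable (F (\<Inter>i. x i))" unfolding pmeet_INT .
  ultimately show ?thesis using k(1) by blast
qed

lemma stable_field_in_closure: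
  assumes sep: "essentially_separable M"
  shows "stb \<in> seq_monotone_closure M B"
proof -
  obtain d :: "nat \<Rightarrow> 'a \<Rightarrow> real" where d: "\<And>i. d i \<in> L2"
    "\<And>u e. u \<in> L2 \<Longrightarrow> e > 0 \<Longrightarrow> \<exists>i. nsq (u \<ominus> d i) < e"
    using separable_real[OF sep] by blast
  obtain f :: "nat \<Rightarrow> 'a \<Rightarrow> real" where f: "\<And>i. f i \<in> H1"
    "\<And>u e. u \<in> H1 \<Longrightarrow> e > 0 \<Longrightarrow> \<exists>i. nsq (u \<ominus> f i) < e"
    using H1_separable[OF d] by blast
  define g where "g i = cop (P stb) (d i)" for i
  have g: "g i \<in> L2" "P stb (g i) \<doteq> (\<lambda>w. 0)" for i
    unfolding g_def by (rule cop_L2[OF proj_stb d(1)], rule proj_proj_cop[OF proj_stb d(1)])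
  have "\<forall>m. \<exists>x\<in>B. \<forall>i<Suc m. nsq (N x (f i)) \<le> (1/4)^m \<and> nsq (P x (g i)) \<le> (1/4)^m"
    using thinning_exists[OF f(1) g] by simp
  then obtain x where x: "\<And>m. x m \<in> B"
    and xfg: "\<And>m. \<forall>i<Suc m. nsq (N (x m) (f i)) \<le> (1/4)^m \<and> nsq (P (x m) (g i)) \<le> (1/4)^m"
    by metis
  have xf: "nsq (N (x m) (f i)) \<le> (1/4)^m" and xg: "nsq (P (x m) (g i)) \<le> (1/4)^m"
    if "i \<le> m" for m i using xfg[of m] that by auto
  define z where "z n = (\<Inter>i. x (n + i))" for n
  have zc: "z n \<in> complete_subfields M" for n unfolding z_def by (intro csub_INT B_csub x)
  have z_cl: "z n \<in> seq_monotone_closure M B" for n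
  proof -
    have "(\<Inter>j. pmeet (\<lambda>i. x (n + i)) j) \<in> seq_monotone_closure M B"
    proof (rule seq_monotone_closure.meet)
      show "pmeet (\<lambda>i. x (n + i)) j \<in> seq_monotone_closure M B" for j
        by (rule seq_monotone_closure.base[OF pmeet_B[OF x]])
      show "decseq (pmeet (\<lambda>i. x (n + i)))"
        unfolding decseq_def using pmeet_antimono by blast
    qed
    then show ?thesis by (simp add: pmeet_INT z_def)
  qed
  define y where "y = sigma_sets (space M) (\<Union>n. z n)"
  have "incseq z"
  proof (rule incseq_SucI)
    fix n
    show "z n \<subseteq> z (Suc n)" unfolding z_def
    proof (intro INT_greatest)
      fix i
      have "(\<Inter>i. x (n + i)) \<subseteq> x (n + Suc i)" by blast
      then show "(\<Inter>i. x (n + i)) \<subseteq> x (Suc n + i)" by simp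
    qed
  qed
  then have y_cl: "y \<in> seq_monotone_closure M B"
    unfolding y_def using z_cl by (intro seq_monotone_closure.join) auto
  have yc: "y \<in> complete_subfields M"
    unfolding y_def using csubD(2,3)[OF zc] by (intro csub_sigma_sets) blast+
  have zy: "z n \<subseteq> y" for n unfolding y_def by auto
  have "stb \<subseteq> y"
  proof (rule stb_least[OF yc])
    fix u assume u: "u \<in> H1"
    note T = proj_cop[OF proj_P[OF yc]]
    have f0: "nsq (cop (P y) (f i)) = 0" for i
    proof -
      have "nsq (cop (P y) (f i)) \<le> 8 * (1/4)^n" if n: "i \<le> n" for n
      proof -
        have "\<exists>k\<in>L2. k \<in> borel_measurable (F (z n)) \<and> nsq (f i \<ominus> k) \<le> 8 * (1/4)^n"
          unfolding z_def by (rule meet_approx[OF x H1_L2[OF f(1)] xf]) (use n in simp)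
        then obtain k where k: "k \<in> L2" "k \<in> borel_measurable (F (z n))" "nsq (f i \<ominus> k) \<le> 8 * (1/4)^n"
          by blast
        have "k \<in> borel_measurable (F y)" by (rule measF_mono[OF zc yc zy k(2)])
        then show ?thesis using best_approx[OF yc H1_L2[OF f(1)] k(1), of i] k(3) by linarith
      qed
      then have "\<exists>n0. \<forall>n\<ge>n0. nsq (cop (P y) (f i)) \<le> 8 * (1/4)^n" by blast
      moreover have "(\<lambda>n. 8 * (1/4::real)^n) \<longlonglongrightarrow> 0"
        by (intro tendsto_mult_right_zero LIMSEQ_power_zero) simp
      ultimately have "nsq (cop (P y) (f i)) \<le> 0" by (rule LIMSEQ_le_const[rotated])
      then show ?thesis using nsq_nonneg[of "cop (P y) (f i)"] by linarith
    qed
    have "nsq (cop (P y) u) \<le> 0 + e" if e: "e > 0" for e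
    proof -
      obtain i where i: "nsq (u \<ominus> f i) < e / 2" using f(2)[OF u, of "e / 2"] e by auto
      show ?thesis using proj_near[OF T H1_L2[OF u] H1_L2[OF f(1)[of i]]] i f0[of i] by linarith
    qed
    then have "nsq (cop (P y) u) \<le> 0" by (rule field_le_epsilon)
    then have "cop (P y) u \<doteq> (\<lambda>w. 0)"
      using nsq_nonneg[of "cop (P y) u"] nsq_eq_0[OF proj_L2[OF T H1_L2[OF u]]] by simp
    then show "u \<in> borel_measurable (F y)"
      by (intro P_fixD[OF yc H1_L2[OF u]]) (simp add: cop_eq_0)
  qed
  moreover have "y \<subseteq> stb"
  proof -
    have "z n \<subseteq> stb" for n
    proof
      fix A assume A: "A \<in> z n"
      then have AM: "A \<in> events" using csubD(2)[OF zc] by blast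
      let ?u = "indicator A :: 'a \<Rightarrow> real"
      let ?g = "cop (P stb) ?u"
      note u = L2_indicator[OF AM]
      note T = proj_cop[OF proj_stb]
      have gL: "?g \<in> L2" by (rule proj_L2[OF T u])
      have fixed: "nsq ?g = nsq (P (x m) ?g)" if m: "n \<le> m" for m
      proof (rule nsq_cong)
        have "A \<in> x (n + (m - n))" using A unfolding z_def by blast
        then have "A \<in> x m" using m by simp
        then have "P (x m) ?u \<doteq> ?u" by (intro P_fix B_csub x u measF_indicator)
        then have "cop (P stb) (P (x m) ?u) \<doteq> ?g"
          by (rule proj_cong[OF T _ P_L2B[OF x u] u])
        then show "?g \<doteq> P (x m) ?g"
          using commuteD[OF commute_cop[OF proj_PB[OF x] proj_stb commute_stb[OF x]] u, of m]
          by (blast intro: aeq_trans aeq_sym)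
      qed (rule gL, rule P_L2B[OF x gL])
      have "nsq ?g \<le> 0 + e" if e: "e > 0" for e
      proof -
        obtain i where i: "nsq (?u \<ominus> d i) < e / 4" using d(2)[OF u, of "e / 4"] e by auto
        have "(\<lambda>m. (1/4::real)^m) \<longlonglongrightarrow> 0" by (intro LIMSEQ_power_zero) simp
        then have "\<forall>\<^sub>F m in sequentially. (1/4::real)^m < e / 4" using e by (intro order_tendstoD) auto
        then have "\<forall>\<^sub>F m in sequentially. (1/4::real)^m < e / 4 \<and> max i n \<le> m"
          using eventually_ge_at_top[of "max i n"] by (rule eventually_conj)
        then obtain m where m: "(1/4::real)^m < e / 4" "i \<le> m" "n \<le> m"
          by (auto simp: eventually_sequentially)
        have "nsq (?g \<ominus> g i) = nsq (cop (P stb) (?u \<ominus> d i))"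
          unfolding g_def
          by (intro nsq_cong aeq_sym[OF proj_fdiff[OF T u d(1)]] L2_fdiff gL g[unfolded g_def]
                proj_L2[OF T] u d(1))
        also have "\<dots> \<le> nsq (?u \<ominus> d i)" by (rule nsq_proj_le[OF T L2_fdiff[OF u d(1)]])
        finally have "nsq (?g \<ominus> g i) < e / 4" using i by linarith
        moreover have "nsq (P (x m) (g i)) < e / 4" using xg[OF m(2)] m(1) by linarith
        ultimately show ?thesis
          using proj_near[OF proj_PB[OF x[of m]] gL g(1)[of i]] fixed[OF m(3)] by linarith
      qed
      then have "nsq ?g \<le> 0" by (rule field_le_epsilon)
      then have "?g \<doteq> (\<lambda>w. 0)" using nsq_nonneg[of ?g] nsq_eq_0[OF gL] by simp
      then have "?u \<in> borel_measurable (F stb)"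
        by (intro P_fixD[OF stb_csub u]) (simp add: cop_eq_0)
      from measurable_sets[OF this, of "{1}"]
      have "?u -` {1} \<inter> space M \<in> stb" by (simp add: sets_F[OF stb_csub] space_F[OF stb_csub])
      moreover have "?u -` {1} \<inter> space M = A"
        using sets.sets_into_space[OF AM] by (auto simp: indicator_def split: if_splits)
      ultimately show "A \<in> stb" by simp
    qed
    then show ?thesis unfolding y_def
      by (intro sigma_algebra.sigma_sets_subset[OF csubD(1)[OF stb_csub]]) blast
  qed
  ultimately have "stb = y" by blast
  then show ?thesis using y_cl by simp
qed

end

theorem theoremA1:
  fixes M :: "'a measure" and B :: "'a set set set"
  assumes "prob_space M"
    and "essentially_separable M"
    and "noise_Boolean_algebra M B"
  shows "stable_field M B \<in> seq_monotone_closure M B"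
proof -
  interpret prob_space M by fact
  interpret noise M B by standard fact
  show ?thesis by (rule stable_field_in_closure[OF assms(2)])
qed

end
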